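(* Let $\zeta$ be a unit vector field with totally geodesic integral curves (i.e. $\nabla_\zeta\zeta=0$) on a compact Riemannian $3$-manifold $(M,g)$. If $\operatorname{Ric}(\zeta,\zeta)>0$ on $M$, then the dual $1$-form $\eta=g(\zeta,\cdot)$ defines a contact structure, i.e. $\eta\wedge d\eta$ is nowhere zero on $M$.
   Context: $\nabla$ is the Levi-Civita connection and $\operatorname{Ric}$ is the Ricci tensor of $(M,g)$, normalized to be positive on round spheres. Compact manifolds have no boundary. *)

theory Defs
  imports "HOL-Analysis.Analysis"
begin

primrec Ck_on :: "nat \<Rightarrow> 'a::euclidean_space set \<Rightarrow> ('a \<Rightarrow> 'b::real_normed_vector) \<Rightarrow> bool" where
  "Ck_on 0 S f \<longleftrightarrow> continuous_on S f"
| "Ck_on (Suc k) S f \<longleftrightarrow>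
     (\<forall>x\<in>S. f differentiable (at x)) \<and> (\<forall>v. Ck_on k S (\<lambda>x. frechet_derivative f (at x) v))"

definition smooth_on :: "'a::euclidean_space set \<Rightarrow> ('a \<Rightarrow> 'b::real_normed_vector) \<Rightarrow> bool" where
  "smooth_on S f \<longleftrightarrow> open S \<and> (\<forall>k. Ck_on k S f)"

text \<open>A chart is a pair of a coordinate domain \<open>U\<close> and a coordinate map, of which only the
  restriction to \<open>U\<close> matters. Chart images are open in the whole space, so there is no boundary.
  Atlases need not be maximal.\<close>

type_synonym ('a, 'n) chart = "'a set \<times> ('a \<Rightarrow> real^'n)"

definition chart_image :: "('a, 'n::finite) chart \<Rightarrow> (real^'n) set" where
  "chart_image c = snd c ` fst c"

definition transition :: "('a, 'n::finite) chart \<Rightarrow> ('a, 'n) chart \<Rightarrow> real^'n \<Rightarrow> real^'n" where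
  "transition c d = snd d \<circ> inv_into (fst c) (snd c)"

definition overlap :: "('a, 'n::finite) chart \<Rightarrow> ('a, 'n) chart \<Rightarrow> (real^'n) set" where
  "overlap c d = snd c ` (fst c \<inter> fst d)"

definition smooth_atlas :: "'a topology \<Rightarrow> ('a, 'n::finite) chart set \<Rightarrow> bool" where
  "smooth_atlas M A \<longleftrightarrow>
     (\<Union>c\<in>A. fst c) = topspace M \<and>
     (\<forall>c\<in>A. openin M (fst c) \<and> open (chart_image c) \<and>
        homeomorphic_map (subtopology M (fst c)) (top_of_set (chart_image c)) (snd c)) \<and>
     (\<forall>c\<in>A. \<forall>d\<in>A. smooth_on (overlap c d) (transition c d))"

definition smooth_manifold :: "'a topology \<Rightarrow> ('a, 'n::finite) chart set \<Rightarrow> bool" where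
  "smooth_manifold M A \<longleftrightarrow> Hausdorff_space M \<and> second_countable M \<and> smooth_atlas M A"

text \<open>A tensor field is given by its components in every chart \<open>c\<close> of the atlas, as functions on
  \<open>chart_image c\<close>, subject to the transformation law under coordinate changes.
  Values outside \<open>chart_image c\<close> are irrelevant.\<close>

definition smooth_vector_field ::
    "('a, 'n::finite) chart set \<Rightarrow> (('a, 'n) chart \<Rightarrow> real^'n \<Rightarrow> real^'n) \<Rightarrow> bool" where
  "smooth_vector_field A X \<longleftrightarrow>
     (\<forall>c\<in>A. smooth_on (chart_image c) (X c)) \<and>
     (\<forall>c\<in>A. \<forall>d\<in>A. \<forall>x\<in>overlap c d.
        X d (transition c d x) = frechet_derivative (transition c d) (at x) (X c x))"

definition smooth_one_form ::
    "('a, 'n::finite) chart set \<Rightarrow> (('a, 'n) chart \<Rightarrow> real^'n \<Rightarrow> real^'n \<Rightarrow> real) \<Rightarrow> bool" where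
  "smooth_one_form A \<alpha> \<longleftrightarrow>
     (\<forall>c\<in>A. \<forall>x\<in>chart_image c. linear (\<alpha> c x)) \<and>
     (\<forall>c\<in>A. \<forall>v. smooth_on (chart_image c) (\<lambda>x. \<alpha> c x v)) \<and>
     (\<forall>c\<in>A. \<forall>d\<in>A. \<forall>x\<in>overlap c d. \<forall>v.
        \<alpha> d (transition c d x) (frechet_derivative (transition c d) (at x) v) = \<alpha> c x v)"

definition gram_form :: "real^'n^'n \<Rightarrow> real^'n \<Rightarrow> real^'n \<Rightarrow> real" where
  "gram_form B u v = u \<bullet> (B *v v)"

definition metric_on :: "(real^'n) set \<Rightarrow> (real^'n \<Rightarrow> real^'n^'n::finite) \<Rightarrow> bool" where
  "metric_on S G \<longleftrightarrow> smooth_on S G \<and>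
     (\<forall>x\<in>S. transpose (G x) = G x \<and> (\<forall>v. v \<noteq> 0 \<longrightarrow> gram_form (G x) v v > 0))"

definition riemannian_metric ::
    "('a, 'n::finite) chart set \<Rightarrow> (('a, 'n) chart \<Rightarrow> real^'n \<Rightarrow> real^'n^'n) \<Rightarrow> bool" where
  "riemannian_metric A g \<longleftrightarrow>
     (\<forall>c\<in>A. metric_on (chart_image c) (g c)) \<and>
     (\<forall>c\<in>A. \<forall>d\<in>A. \<forall>x\<in>overlap c d. \<forall>u v.
        gram_form (g d (transition c d x))
          (frechet_derivative (transition c d) (at x) u)
          (frechet_derivative (transition c d) (at x) v) = gram_form (g c x) u v)"

definition riemannian_manifold ::
    "'a topology \<Rightarrow> ('a, 'n::finite) chart set \<Rightarrow> (('a, 'n) chart \<Rightarrow> real^'n \<Rightarrow> real^'n^'n) \<Rightarrow> bool"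
  where "riemannian_manifold M A g \<longleftrightarrow> smooth_manifold M A \<and> riemannian_metric A g"

text \<open>In the next definitions \<open>G\<close> is the Gram matrix of the metric in one chart and vector fields are maps
  on the chart image.\<close>

definition partial_deriv :: "'n::finite \<Rightarrow> (real^'n \<Rightarrow> real) \<Rightarrow> real^'n \<Rightarrow> real" where
  "partial_deriv i f x = frechet_derivative f (at x) (axis i 1)"

definition christoffel ::
    "(real^'n \<Rightarrow> real^'n^'n) \<Rightarrow> real^'n \<Rightarrow> 'n \<Rightarrow> 'n \<Rightarrow> 'n::finite \<Rightarrow> real" where
  "christoffel G x k i j = (1/2) * (\<Sum>l\<in>UNIV. matrix_inv (G x) $ k $ l *
      (partial_deriv i (\<lambda>y. G y $ j $ l) x + partial_deriv j (\<lambda>y. G y $ i $ l) x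
        - partial_deriv l (\<lambda>y. G y $ i $ j) x))"

text \<open>\<open>cov_deriv G X Y\<close> is \<open>\<nabla>\<^sub>X Y\<close> for the Levi-Civita connection; that it is torsion-free and
  metric, and the only such connection, is \<open>cov_deriv_torsion_free\<close>, \<open>cov_deriv_metric\<close> and
  \<open>levi_civita_unique\<close> below.\<close>

definition cov_deriv ::
    "(real^'n \<Rightarrow> real^'n^'n) \<Rightarrow> (real^'n \<Rightarrow> real^'n) \<Rightarrow> (real^'n \<Rightarrow> real^'n) \<Rightarrow> real^'n::finite \<Rightarrow> real^'n"
  where "cov_deriv G X Y x = frechet_derivative Y (at x) (X x)
      + (\<chi> k. \<Sum>i\<in>UNIV. \<Sum>j\<in>UNIV. christoffel G x k i j * X x $ i * Y x $ j)"

definition lie_bracket ::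
    "(real^'n \<Rightarrow> real^'n) \<Rightarrow> (real^'n \<Rightarrow> real^'n) \<Rightarrow> real^'n::finite \<Rightarrow> real^'n" where
  "lie_bracket X Y x = frechet_derivative Y (at x) (X x) - frechet_derivative X (at x) (Y x)"

definition curvature ::
    "(real^'n \<Rightarrow> real^'n^'n) \<Rightarrow> (real^'n \<Rightarrow> real^'n) \<Rightarrow> (real^'n \<Rightarrow> real^'n) \<Rightarrow> (real^'n \<Rightarrow> real^'n)
      \<Rightarrow> real^'n::finite \<Rightarrow> real^'n" where
  "curvature G X Y Z x = cov_deriv G X (cov_deriv G Y Z) x - cov_deriv G Y (cov_deriv G X Z) x
      - cov_deriv G (lie_bracket X Y) Z x"

text \<open>\<open>Ric(v,w)\<close> is the trace of \<open>u \<mapsto> R(u,v)w\<close>; since \<open>R\<close> is a tensor, tangent vectors may be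
  extended to vector fields with constant components. With this sign \<open>Ric\<close> is positive on round
  spheres.\<close>

definition ricci ::
    "(real^'n \<Rightarrow> real^'n^'n) \<Rightarrow> real^'n \<Rightarrow> real^'n \<Rightarrow> real^'n::finite \<Rightarrow> real" where
  "ricci G x v w = trace (matrix (\<lambda>u. curvature G (\<lambda>_. u) (\<lambda>_. v) (\<lambda>_. w) x))"

definition ext_deriv :: "(real^'n \<Rightarrow> real^'n \<Rightarrow> real) \<Rightarrow> real^'n::finite \<Rightarrow> real^'n \<Rightarrow> real^'n \<Rightarrow> real" where
  "ext_deriv \<alpha> x u v =
     frechet_derivative (\<lambda>y. \<alpha> y v) (at x) u - frechet_derivative (\<lambda>y. \<alpha> y u) (at x) v"

text \<open>Exterior product of a linear form and an alternating 2-form.\<close>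

definition wedge12 :: "('v \<Rightarrow> real) \<Rightarrow> ('v \<Rightarrow> 'v \<Rightarrow> real) \<Rightarrow> 'v \<Rightarrow> 'v \<Rightarrow> 'v \<Rightarrow> real" where
  "wedge12 a b u v w = a u * b v w + a v * b w u + a w * b u v"

definition contact_form_3 ::
    "('a, 3) chart set \<Rightarrow> (('a, 3) chart \<Rightarrow> real^3 \<Rightarrow> real^3 \<Rightarrow> real) \<Rightarrow> bool" where
  "contact_form_3 A \<alpha> \<longleftrightarrow> smooth_one_form A \<alpha> \<and>
     (\<forall>c\<in>A. \<forall>x\<in>chart_image c. \<exists>u v w. wedge12 (\<alpha> c x) (ext_deriv (\<alpha> c) x) u v w \<noteq> 0)"

definition dual_one_form ::
    "(('a, 'n::finite) chart \<Rightarrow> real^'n \<Rightarrow> real^'n^'n) \<Rightarrow> (('a, 'n) chart \<Rightarrow> real^'n \<Rightarrow> real^'n)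
      \<Rightarrow> ('a, 'n) chart \<Rightarrow> real^'n \<Rightarrow> real^'n \<Rightarrow> real" where
  "dual_one_form g X c x v = gram_form (g c x) (X c x) v"

lemma smooth_on_differentiable: "smooth_on S f \<Longrightarrow> x \<in> S \<Longrightarrow> f differentiable (at x)"
  unfolding smooth_on_def by (metis Ck_on.simps(2))

lemma Ck_on_const: "Ck_on k S (\<lambda>_. c)"
  by (induction k arbitrary: c) (auto simp: frechet_derivative_const)

lemma smooth_on_const: "open S \<Longrightarrow> smooth_on S (\<lambda>_. c)"
  by (simp add: smooth_on_def Ck_on_const)

lemma gram_form_sym:
  assumes "transpose B = B"
  shows "gram_form B u v = gram_form B v u"
  unfolding gram_form_def by (metis assms dot_lmul_matrix inner_commute transpose_matrix_vector)

lemma gram_form_add_left: "gram_form B (u + u') v = gram_form B u v + gram_form B u' v"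
  and gram_form_diff_left: "gram_form B (u - u') v = gram_form B u v - gram_form B u' v"
  by (simp_all add: gram_form_def inner_add_left inner_diff_left)

lemma gram_form_add_right: "gram_form B u (v + v') = gram_form B u v + gram_form B u v'"
  and gram_form_diff_right: "gram_form B u (v - v') = gram_form B u v - gram_form B u v'"
  by (simp_all add: gram_form_def inner_add_right inner_diff_right matrix_vector_right_distrib
      matrix_vector_mult_diff_distrib)

lemma gram_form_has_derivative:
  fixes G :: "real^'n \<Rightarrow> real^'n^'n::finite"
  assumes "(G has_derivative G') (at x)" "(Y has_derivative Y') (at x)" "(Z has_derivative Z') (at x)"
  shows "((\<lambda>y. gram_form (G y) (Y y) (Z y)) has_derivative
    (\<lambda>h. gram_form (G' h) (Y x) (Z x) + gram_form (G x) (Y' h) (Z x) + gram_form (G x) (Y x) (Z' h))) (at x)"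
proof -
  have bb: "bounded_bilinear ((*v) :: real^'n^'n \<Rightarrow> real^'n \<Rightarrow> real^'n)"
  proof (rule bilinear_conv_bounded_bilinear[THEN iffD1])
    show "bilinear ((*v) :: real^'n^'n \<Rightarrow> real^'n \<Rightarrow> real^'n)"
      by (auto simp: bilinear_def linear_iff matrix_vector_mult_add_rdistrib matrix_vector_right_distrib
          scaleR_matrix_vector_assoc matrix_vector_mult_scaleR)
  qed
  show ?thesis
    unfolding gram_form_def
    by (rule has_derivative_eq_rhs,
        rule has_derivative_inner[OF assms(2) bounded_bilinear.FDERIV[OF bb assms(1,3)]])
      (auto simp: inner_add_right)
qed

definition christoffel_vec ::
    "(real^'n \<Rightarrow> real^'n^'n) \<Rightarrow> real^'n \<Rightarrow> real^'n \<Rightarrow> real^'n \<Rightarrow> real^'n::finite" where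
  "christoffel_vec G x u v = (\<chi> k. \<Sum>i\<in>UNIV. \<Sum>j\<in>UNIV. christoffel G x k i j * u $ i * v $ j)"

lemma gram_form_christoffel:
  fixes G :: "real^'n \<Rightarrow> real^'n^'n::finite"
  assumes G': "(G has_derivative G') (at x)" and sym: "transpose (G x) = G x"
    and inv: "invertible (G x)"
  shows "gram_form (G x) (christoffel_vec G x u v) w =
    (gram_form (G' u) v w + gram_form (G' v) u w - gram_form (G' w) u v) / 2"
proof -
  have pd: "partial_deriv i (\<lambda>y. G y $ j $ l) x = G' (axis i 1) $ j $ l" for i j l
  proof -
    have "((\<lambda>y. G y $ j $ l) has_derivative (\<lambda>h. G' h $ j $ l)) (at x)"
      by (intro bounded_linear.has_derivative[OF bounded_linear_vec_nth] G')
    then show ?thesis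
      unfolding partial_deriv_def by (metis frechet_derivative_at)
  qed
  have lin: "linear G'"
    using G' has_derivative_linear by blast
  have expand: "gram_form (G' a) b c = (\<Sum>i\<in>UNIV. \<Sum>j\<in>UNIV. \<Sum>l\<in>UNIV. a $ i * b $ j * c $ l * G' (axis i 1) $ j $ l)"
    for a b c
  proof -
    have "G' a = G' (\<Sum>i\<in>UNIV. a $ i *\<^sub>R axis i 1)"
      by (simp add: basis_expansion[of a, unfolded scalar_mult_eq_scaleR])
    also have "\<dots> = (\<Sum>i\<in>UNIV. a $ i *\<^sub>R G' (axis i 1))"
      by (simp add: linear_sum[OF lin] linear_scale[OF lin])
    finally have "gram_form (G' a) b c = (\<Sum>j\<in>UNIV. \<Sum>l\<in>UNIV. \<Sum>i\<in>UNIV. a $ i * b $ j * c $ l * G' (axis i 1) $ j $ l)"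
      by (simp add: gram_form_def inner_vec_def matrix_vector_mult_def sum_distrib_left sum_distrib_right mult_ac)
    also have "\<dots> = (\<Sum>j\<in>UNIV. \<Sum>i\<in>UNIV. \<Sum>l\<in>UNIV. a $ i * b $ j * c $ l * G' (axis i 1) $ j $ l)"
      by (rule sum.cong[OF refl sum.swap])
    also have "\<dots> = (\<Sum>i\<in>UNIV. \<Sum>j\<in>UNIV. \<Sum>l\<in>UNIV. a $ i * b $ j * c $ l * G' (axis i 1) $ j $ l)"
      by (rule sum.swap)
    finally show ?thesis .
  qed
  define q :: "real^'n" where "q = (\<chi> l. \<Sum>i\<in>UNIV. \<Sum>j\<in>UNIV. u $ i * v $ j / 2 *
      (G' (axis i 1) $ j $ l + G' (axis j 1) $ i $ l - G' (axis l 1) $ i $ j))"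
  have cq: "christoffel_vec G x u v = matrix_inv (G x) *v q"
  proof -
    have "christoffel_vec G x u v $ k = (matrix_inv (G x) *v q) $ k" for k
    proof -
      have "christoffel_vec G x u v $ k = (\<Sum>i\<in>UNIV. \<Sum>j\<in>UNIV. \<Sum>l\<in>UNIV. matrix_inv (G x) $ k $ l * (u $ i * v $ j / 2 *
          (G' (axis i 1) $ j $ l + G' (axis j 1) $ i $ l - G' (axis l 1) $ i $ j)))"
        by (simp add: christoffel_vec_def christoffel_def pd sum_distrib_left sum_distrib_right mult_ac)
      also have "\<dots> = (\<Sum>i\<in>UNIV. \<Sum>l\<in>UNIV. \<Sum>j\<in>UNIV. matrix_inv (G x) $ k $ l * (u $ i * v $ j / 2 *
          (G' (axis i 1) $ j $ l + G' (axis j 1) $ i $ l - G' (axis l 1) $ i $ j)))"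
        by (rule sum.cong[OF refl sum.swap])
      also have "\<dots> = (\<Sum>l\<in>UNIV. \<Sum>i\<in>UNIV. \<Sum>j\<in>UNIV. matrix_inv (G x) $ k $ l * (u $ i * v $ j / 2 *
          (G' (axis i 1) $ j $ l + G' (axis j 1) $ i $ l - G' (axis l 1) $ i $ j)))"
        by (rule sum.swap)
      also have "\<dots> = (matrix_inv (G x) *v q) $ k"
        by (simp add: q_def matrix_vector_mult_def sum_distrib_left)
      finally show ?thesis .
    qed
    then show ?thesis by (simp add: vec_eq_iff)
  qed
  have "G x ** matrix_inv (G x) = mat 1"
    using inv unfolding invertible_def matrix_inv_def by (rule someI_ex[THEN conjunct1])
  then have "G x *v christoffel_vec G x u v = q"
    by (simp add: cq matrix_vector_mul_assoc)
  then have "gram_form (G x) (christoffel_vec G x u v) w = w \<bullet> q"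
    by (simp add: gram_form_sym[OF sym, of _ w]) (simp add: gram_form_def)
  also have "\<dots> = (\<Sum>l\<in>UNIV. \<Sum>i\<in>UNIV. \<Sum>j\<in>UNIV. u $ i * v $ j * w $ l / 2 *
      (G' (axis i 1) $ j $ l + G' (axis j 1) $ i $ l - G' (axis l 1) $ i $ j))"
    by (simp add: q_def inner_vec_def sum_distrib_left mult_ac)
  also have "\<dots> = ((\<Sum>l\<in>UNIV. \<Sum>i\<in>UNIV. \<Sum>j\<in>UNIV. u $ i * v $ j * w $ l * G' (axis i 1) $ j $ l)
      + (\<Sum>l\<in>UNIV. \<Sum>i\<in>UNIV. \<Sum>j\<in>UNIV. u $ i * v $ j * w $ l * G' (axis j 1) $ i $ l)
      - (\<Sum>l\<in>UNIV. \<Sum>i\<in>UNIV. \<Sum>j\<in>UNIV. u $ i * v $ j * w $ l * G' (axis l 1) $ i $ j)) / 2"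
    by (simp add: sum_divide_distrib add_divide_distrib diff_divide_distrib sum.distrib sum_subtractf distrib_left right_diff_distrib)
  also have "(\<Sum>l\<in>UNIV. \<Sum>i\<in>UNIV. \<Sum>j\<in>UNIV. u $ i * v $ j * w $ l * G' (axis i 1) $ j $ l) = gram_form (G' u) v w"
  proof -
    have "(\<Sum>l\<in>UNIV. \<Sum>i\<in>UNIV. \<Sum>j\<in>UNIV. u $ i * v $ j * w $ l * G' (axis i 1) $ j $ l)
        = (\<Sum>i\<in>UNIV. \<Sum>l\<in>UNIV. \<Sum>j\<in>UNIV. u $ i * v $ j * w $ l * G' (axis i 1) $ j $ l)"
      by (rule sum.swap)
    also have "\<dots> = (\<Sum>i\<in>UNIV. \<Sum>j\<in>UNIV. \<Sum>l\<in>UNIV. u $ i * v $ j * w $ l * G' (axis i 1) $ j $ l)"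
      by (rule sum.cong[OF refl sum.swap])
    finally show ?thesis by (simp add: expand)
  qed
  also have "(\<Sum>l\<in>UNIV. \<Sum>i\<in>UNIV. \<Sum>j\<in>UNIV. u $ i * v $ j * w $ l * G' (axis j 1) $ i $ l) = gram_form (G' v) u w"
  proof -
    have "(\<Sum>l\<in>UNIV. \<Sum>i\<in>UNIV. \<Sum>j\<in>UNIV. u $ i * v $ j * w $ l * G' (axis j 1) $ i $ l)
        = (\<Sum>l\<in>UNIV. \<Sum>j\<in>UNIV. \<Sum>i\<in>UNIV. u $ i * v $ j * w $ l * G' (axis j 1) $ i $ l)"
      by (rule sum.cong[OF refl sum.swap])
    also have "\<dots> = (\<Sum>j\<in>UNIV. \<Sum>l\<in>UNIV. \<Sum>i\<in>UNIV. u $ i * v $ j * w $ l * G' (axis j 1) $ i $ l)"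
      by (rule sum.swap)
    also have "\<dots> = (\<Sum>j\<in>UNIV. \<Sum>i\<in>UNIV. \<Sum>l\<in>UNIV. u $ i * v $ j * w $ l * G' (axis j 1) $ i $ l)"
      by (rule sum.cong[OF refl sum.swap])
    finally show ?thesis by (simp add: expand mult_ac)
  qed
  also have "(\<Sum>l\<in>UNIV. \<Sum>i\<in>UNIV. \<Sum>j\<in>UNIV. u $ i * v $ j * w $ l * G' (axis l 1) $ i $ j) = gram_form (G' w) u v"
    by (simp add: expand mult_ac)
  finally show ?thesis .
qed

context
  fixes S :: "(real^'n::finite) set" and G :: "real^'n \<Rightarrow> real^'n^'n"
  assumes metric: "metric_on S G"
begin

lemma metric_on_open: "open S"
  using metric by (simp add: metric_on_def smooth_on_def)

lemma metric_on_deriv: "x \<in> S \<Longrightarrow> (G has_derivative frechet_derivative G (at x)) (at x)"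
  using metric frechet_derivative_works smooth_on_differentiable unfolding metric_on_def by blast

lemma metric_on_sym: "x \<in> S \<Longrightarrow> transpose (G x) = G x"
  using metric by (simp add: metric_on_def)

lemma metric_on_pos: "x \<in> S \<Longrightarrow> v \<noteq> 0 \<Longrightarrow> gram_form (G x) v v > 0"
  using metric by (simp add: metric_on_def)

lemma metric_on_invertible:
  assumes "x \<in> S"
  shows "invertible (G x)"
proof -
  have "v = 0" if "G x *v v = 0" for v
    using metric_on_pos[OF assms, of v] that by (auto simp: gram_form_def)
  then have "inj ((*v) (G x))"
    by (metis matrix_left_invertible_injective matrix_left_invertible_ker)
  then show ?thesis
    using invertible_left_inverse matrix_left_invertible_injective by blast
qed

lemma metric_on_deriv_sym:
  assumes x: "x \<in> S"
  shows "gram_form (frechet_derivative G (at x) h) u v = gram_form (frechet_derivative G (at x) h) v u"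
proof -
  have d: "((\<lambda>y. gram_form (G y) u v) has_derivative
      (\<lambda>h. gram_form (frechet_derivative G (at x) h) u v)) (at x)" for u v
    using gram_form_has_derivative[OF metric_on_deriv[OF x] has_derivative_const has_derivative_const]
    by (simp add: gram_form_def)
  have "((\<lambda>y. gram_form (G y) u v) has_derivative
      (\<lambda>h. gram_form (frechet_derivative G (at x) h) v u)) (at x)"
    by (rule has_derivative_transform_within_open[OF d metric_on_open x])
      (simp add: gram_form_sym[OF metric_on_sym])
  then show ?thesis
    using has_derivative_unique[OF d] by metis
qed

lemma cov_deriv_torsion_free:
  assumes x: "x \<in> S"
  shows "cov_deriv G X Y x - cov_deriv G Y X x = lie_bracket X Y x"
proof -
  have "gram_form (G x) (christoffel_vec G x u v - christoffel_vec G x v u) w = 0" for u v w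
    using metric_on_deriv_sym[OF x]
    by (simp add: gram_form_diff_left
        gram_form_christoffel[OF metric_on_deriv[OF x] metric_on_sym[OF x] metric_on_invertible[OF x]])
  then have "christoffel_vec G x u v = christoffel_vec G x v u" for u v
    by (metis metric_on_pos[OF x] less_irrefl right_minus_eq)
  then show ?thesis
    by (simp add: cov_deriv_def lie_bracket_def flip: christoffel_vec_def)
qed

lemma cov_deriv_metric:
  assumes x: "x \<in> S" and "Y differentiable (at x)" "Z differentiable (at x)"
  shows "frechet_derivative (\<lambda>y. gram_form (G y) (Y y) (Z y)) (at x) (X x) =
    gram_form (G x) (cov_deriv G X Y x) (Z x) + gram_form (G x) (Y x) (cov_deriv G X Z x)"
proof -
  note c = gram_form_christoffel[OF metric_on_deriv[OF x] metric_on_sym[OF x] metric_on_invertible[OF x]]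
  note der = gram_form_has_derivative[OF metric_on_deriv[OF x]
      frechet_derivative_works[THEN iffD1, OF assms(2)] frechet_derivative_works[THEN iffD1, OF assms(3)]]
  have "frechet_derivative (\<lambda>y. gram_form (G y) (Y y) (Z y)) (at x) (X x) =
      gram_form (frechet_derivative G (at x) (X x)) (Y x) (Z x)
      + gram_form (G x) (frechet_derivative Y (at x) (X x)) (Z x)
      + gram_form (G x) (Y x) (frechet_derivative Z (at x) (X x))"
    using has_derivative_unique[OF
        frechet_derivative_works[THEN iffD1, OF differentiableI[OF der]] der]
    by (rule fun_cong)
  moreover have "gram_form (G x) (christoffel_vec G x u v) w + gram_form (G x) v (christoffel_vec G x u w)
      = gram_form (frechet_derivative G (at x) u) v w" for u v w
    unfolding gram_form_sym[OF metric_on_sym[OF x], of v] c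
    using metric_on_deriv_sym[OF x] by (simp add: field_simps)
  ultimately show ?thesis
    by (simp add: cov_deriv_def gram_form_add_left gram_form_add_right flip: christoffel_vec_def)
qed

lemma levi_civita_unique:
  fixes D :: "(real^'n \<Rightarrow> real^'n) \<Rightarrow> (real^'n \<Rightarrow> real^'n) \<Rightarrow> real^'n \<Rightarrow> real^'n"
  assumes torsion_free: "\<And>X Y x. smooth_on S X \<Longrightarrow> smooth_on S Y \<Longrightarrow> x \<in> S \<Longrightarrow>
      D X Y x - D Y X x = lie_bracket X Y x"
    and metric: "\<And>X Y Z x. smooth_on S X \<Longrightarrow> smooth_on S Y \<Longrightarrow> smooth_on S Z \<Longrightarrow> x \<in> S \<Longrightarrow>
      frechet_derivative (\<lambda>y. gram_form (G y) (Y y) (Z y)) (at x) (X x) =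
        gram_form (G x) (D X Y x) (Z x) + gram_form (G x) (Y x) (D X Z x)"
    and XY: "smooth_on S X" "smooth_on S Y" and x: "x \<in> S"
  shows "D X Y x = cov_deriv G X Y x"
proof -
  define E where "E X Y = D X Y x - cov_deriv G X Y x" for X Y
  define T where "T X Y Z = gram_form (G x) (E X Y) (Z x)" for X Y Z
  have E: "E X Y = E Y X" if "smooth_on S X" "smooth_on S Y" for X Y
    using torsion_free[OF that x] cov_deriv_torsion_free[OF x, of X Y]
    by (simp add: E_def algebra_simps)
  have s: "T X Y Z = T Y X Z" if "smooth_on S X" "smooth_on S Y" for X Y Z
    using E[OF that] by (simp add: T_def)
  have a: "T X Y Z = - T X Z Y" if "smooth_on S X" "smooth_on S Y" "smooth_on S Z" for X Y Z
    using metric[OF that x]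
      cov_deriv_metric[OF x smooth_on_differentiable[OF that(2) x] smooth_on_differentiable[OF that(3) x], of X]
    by (simp add: T_def E_def gram_form_diff_left gram_form_diff_right
        gram_form_sym[OF metric_on_sym[OF x], of _ "Y x"])
  define Z where "Z = (\<lambda>_::real^'n. E X Y)"
  have Z: "smooth_on S Z"
    by (simp add: Z_def smooth_on_const metric_on_open)
  have "T X Y Z = - T X Y Z"
    using s a XY Z by metis
  then have "gram_form (G x) (E X Y) (E X Y) = 0"
    by (simp add: T_def Z_def)
  then have "E X Y = 0"
    using metric_on_pos[OF x] by force
  then show ?thesis
    by (simp add: E_def)
qed

end

end

theory Submission
  imports Defs
begin

text \<open>Let \<open>S = \<nabla>\<zeta>\<close>, \<open>\<theta> = tr S = div \<zeta>\<close>, and let \<open>\<omega>\<close> be the ratio of \<open>\<eta> \<and> d\<eta>\<close> to a local volume form. Two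
  evolution equations hold along \<open>\<zeta>\<close>. The traced Riccati equation (\<open>divergence_riccati\<close>) is
  \<open>\<zeta>(\<theta>) = - tr S\<^sup>2 - Ric(\<zeta>,\<zeta>)\<close>. Further, \<open>d\<eta>(\<zeta>,\<cdot>) = 0\<close> because \<open>\<zeta>\<close> is a geodesic unit field, so \<open>\<zeta>\<close> preserves
  \<open>\<eta> \<and> d\<eta>\<close> and \<open>\<zeta>(\<omega>\<^sup>2) = - 2 \<theta> \<omega>\<^sup>2\<close> (\<open>twist_sq_transport\<close>).

  At a zero of \<open>\<omega>\<close> the 2-form \<open>d\<eta>\<close>, which is twice the skew-symmetric part of \<open>S\<close>, vanishes. There \<open>S\<close> is self-adjoint,
  so \<open>tr S\<^sup>2 \<ge> 0\<close> and \<open>\<zeta>(\<theta>) < 0\<close> (\<open>divergence_decreasing_if_no_twist\<close>). The zero set \<open>N\<close> of \<open>\<omega>\<close> is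
  closed and, by the second equation, invariant under the flow of \<open>\<zeta>\<close>. If it were nonempty, \<open>\<theta>\<close> would attain a
  minimum over the compact set \<open>N\<close> at a point where its derivative along \<open>\<zeta>\<close> is negative, although the flow line
  through that point stays in \<open>N\<close>: a contradiction.

  The flow can be avoided by a penalty argument (\<open>penalty_positive_on_compact\<close>). At a minimum over the manifold of
  \<open>\<theta> + K \<omega>\<^sup>2\<close> the second equation gives \<open>\<zeta>(\<theta>) = 2 K \<theta> \<omega>\<^sup>2\<close>. As \<open>K\<close> grows, \<open>K \<omega>\<^sup>2\<close> tends to zero at the
  minimizers while these approach \<open>N\<close>, where \<open>\<zeta>(\<theta>)\<close> is bounded away from zero.

  The equations are proved in one chart. That \<open>\<theta>\<close>, \<open>\<zeta>(\<theta>)\<close> and \<open>\<omega>\<^sup>2\<close> are functions on the manifold follows from the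
  tensoriality of \<open>\<nabla>\<zeta>\<close> (\<open>nabla_transform\<close>) and of \<open>\<eta> \<and> d\<eta>\<close> (\<open>twist_sq_transform\<close>).\<close>

section \<open>Calculus of smooth maps\<close>

abbreviation D :: "('a::real_normed_vector \<Rightarrow> 'b::real_normed_vector) \<Rightarrow> 'a \<Rightarrow> 'a \<Rightarrow> 'b" where
  "D f x \<equiv> frechet_derivative f (at x)"

lemma D_eqI: "(f has_derivative f') (at x) \<Longrightarrow> D f x = f'"
  using frechet_derivative_at by metis

text \<open>On an open set the values of a map determine its derivatives, so \<open>Ck_on\<close> ignores what happens outside.
  Every closure property below computes a derivative on \<open>S\<close> only and therefore rests on this lemma.\<close>

lemma Ck_on_cong:
  assumes "open S" "\<And>x. x \<in> S \<Longrightarrow> f x = g x" "Ck_on k S f"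
  shows "Ck_on k S g"
  using assms(2,3)
proof (induction k arbitrary: f g)
  case 0
  then show ?case using continuous_on_cong by (metis Ck_on.simps(1))
next
  case (Suc k)
  have der: "(g has_derivative D f x) (at x)" if "x \<in> S" for x
    using Suc.prems that frechet_derivative_works assms(1)
    by (metis (no_types, lifting) Ck_on.simps(2) has_derivative_transform_within_open)
  have "Ck_on k S (\<lambda>x. D g x v)" for v
    by (rule Suc.IH[of "\<lambda>x. D f x v"]) (use Suc.prems D_eqI[OF der] in auto)
  then show ?case using der by (auto intro: differentiableI)
qed

lemma Ck_on_Suc_has_derivative: "Ck_on (Suc k) S f \<Longrightarrow> x \<in> S \<Longrightarrow> (f has_derivative D f x) (at x)"
  by (simp add: frechet_derivative_works)

lemma Ck_on_Suc_D: "Ck_on (Suc k) S f \<Longrightarrow> Ck_on k S (\<lambda>x. D f x v)"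
  by simp

lemma Ck_on_SucI:
  assumes "open S" "\<And>x. x \<in> S \<Longrightarrow> (f has_derivative f' x) (at x)" "\<And>v. Ck_on k S (\<lambda>x. f' x v)"
  shows "Ck_on (Suc k) S f"
proof -
  have "Ck_on k S (\<lambda>x. D f x v)" for v
    by (rule Ck_on_cong[OF assms(1) _ assms(3)[of v]]) (simp add: D_eqI[OF assms(2)])
  then show ?thesis
    using assms(2) by (auto intro: differentiableI)
qed

lemma Ck_on_Suc_imp: "Ck_on (Suc k) S f \<Longrightarrow> Ck_on k S f"
proof (induction k arbitrary: f)
  case 0
  then show ?case
    by (auto intro!: continuous_at_imp_continuous_on differentiable_imp_continuous_within)
next
  case (Suc k)
  then show ?case by (metis Ck_on.simps(2))
qed

lemma Ck_on_linear:
  assumes "open S" "bounded_linear L" "Ck_on k S f"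
  shows "Ck_on k S (\<lambda>x. L (f x))"
  using assms(3)
proof (induction k arbitrary: f)
  case 0
  then show ?case using assms(2) by (simp add: bounded_linear.continuous_on)
next
  case (Suc k)
  show ?case
    by (rule Ck_on_SucI[OF assms(1) bounded_linear.has_derivative[OF assms(2) Ck_on_Suc_has_derivative[OF Suc.prems]]
          Suc.IH[OF Ck_on_Suc_D[OF Suc.prems]]])
qed

lemma Ck_on_add:
  assumes "open S" "Ck_on k S f" "Ck_on k S g"
  shows "Ck_on k S (\<lambda>x. f x + g x)"
  using assms(2,3)
proof (induction k arbitrary: f g)
  case 0
  then show ?case by (simp add: continuous_on_add)
next
  case (Suc k)
  show ?case
    by (rule Ck_on_SucI[OF assms(1) has_derivative_add[OF Suc.prems[THEN Ck_on_Suc_has_derivative]]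
          Suc.IH[OF Suc.prems[THEN Ck_on_Suc_D]]])
qed

lemma Ck_on_bilinear:
  assumes "open S" "bounded_bilinear p" "Ck_on k S f" "Ck_on k S g"
  shows "Ck_on k S (\<lambda>x. p (f x) (g x))"
  using assms(3,4)
proof (induction k arbitrary: f g)
  case 0
  then show ?case using assms(2) by (simp add: bounded_bilinear.continuous_on)
next
  case (Suc k)
  show ?case
    by (rule Ck_on_SucI[OF assms(1)
          bounded_bilinear.FDERIV[OF assms(2) Suc.prems[THEN Ck_on_Suc_has_derivative]]
          Ck_on_add[OF assms(1)
            Suc.IH[OF Ck_on_Suc_imp[OF Suc.prems(1)] Ck_on_Suc_D[OF Suc.prems(2)]]
            Suc.IH[OF Ck_on_Suc_D[OF Suc.prems(1)] Ck_on_Suc_imp[OF Suc.prems(2)]]]])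
qed

lemma Ck_on_inverse:
  fixes f :: "'a::euclidean_space \<Rightarrow> real"
  assumes "open S" "\<And>x. x \<in> S \<Longrightarrow> f x \<noteq> 0" "Ck_on k S f"
  shows "Ck_on k S (\<lambda>x. inverse (f x))"
  using assms(3)
proof (induction k)
  case 0
  then show ?case using assms(2) by (simp add: continuous_on_inverse)
next
  case (Suc k)
  have inv: "Ck_on k S (\<lambda>x. inverse (f x))"
    using Suc Ck_on_Suc_imp by blast
  show ?case
    by (rule Ck_on_SucI[OF assms(1) Deriv.has_derivative_inverse[OF assms(2) Ck_on_Suc_has_derivative[OF Suc.prems]]])
      (assumption | intro Ck_on_linear[OF assms(1) bounded_linear_minus[OF bounded_linear_ident]]
        Ck_on_bilinear[OF assms(1) bounded_bilinear_mult] inv Ck_on_Suc_D[OF Suc.prems])+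
qed

lemma smooth_on_cong: "smooth_on S f \<Longrightarrow> (\<And>x. x \<in> S \<Longrightarrow> f x = g x) \<Longrightarrow> smooth_on S g"
  unfolding smooth_on_def using Ck_on_cong by blast

lemma smooth_on_linear: "bounded_linear L \<Longrightarrow> smooth_on S f \<Longrightarrow> smooth_on S (\<lambda>x. L (f x))"
  unfolding smooth_on_def using Ck_on_linear by blast

lemma smooth_on_add: "smooth_on S f \<Longrightarrow> smooth_on S g \<Longrightarrow> smooth_on S (\<lambda>x. f x + g x)"
  unfolding smooth_on_def using Ck_on_add by blast

lemma smooth_on_bilinear:
  "bounded_bilinear p \<Longrightarrow> smooth_on S f \<Longrightarrow> smooth_on S g \<Longrightarrow> smooth_on S (\<lambda>x. p (f x) (g x))"
  unfolding smooth_on_def using Ck_on_bilinear by blast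

lemmas smooth_on_mult = smooth_on_bilinear[OF bounded_bilinear_mult]
  and smooth_on_scaleR = smooth_on_bilinear[OF bounded_bilinear_scaleR]
  and smooth_on_nth = smooth_on_linear[OF bounded_linear_vec_nth]

lemma smooth_on_diff: "smooth_on S f \<Longrightarrow> smooth_on S g \<Longrightarrow> smooth_on S (\<lambda>x. f x - g x)"
  using smooth_on_add[of S f "\<lambda>x. - g x"] smooth_on_linear[OF bounded_linear_minus[OF bounded_linear_ident]]
  by fastforce

lemma smooth_on_inverse:
  fixes f :: "'a::euclidean_space \<Rightarrow> real"
  shows "smooth_on S f \<Longrightarrow> (\<And>x. x \<in> S \<Longrightarrow> f x \<noteq> 0) \<Longrightarrow> smooth_on S (\<lambda>x. inverse (f x))"
  unfolding smooth_on_def using Ck_on_inverse by blast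

lemma smooth_on_D: "smooth_on S f \<Longrightarrow> smooth_on S (\<lambda>x. D f x v)"
  unfolding smooth_on_def by (metis Ck_on.simps(2))

lemma smooth_on_sum:
  "open S \<Longrightarrow> (\<And>i. i \<in> I \<Longrightarrow> smooth_on S (f i)) \<Longrightarrow> smooth_on S (\<lambda>x. \<Sum>i\<in>I. f i x)"
  by (induction I rule: infinite_finite_induct) (auto intro: smooth_on_add smooth_on_const)

lemma smooth_on_prod:
  fixes f :: "'i \<Rightarrow> 'a::euclidean_space \<Rightarrow> real"
  shows "open S \<Longrightarrow> (\<And>i. i \<in> I \<Longrightarrow> smooth_on S (f i)) \<Longrightarrow> smooth_on S (\<lambda>x. \<Prod>i\<in>I. f i x)"
  by (induction I rule: infinite_finite_induct) (auto intro: smooth_on_mult smooth_on_const)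

lemma smooth_on_has_derivative: "smooth_on S f \<Longrightarrow> x \<in> S \<Longrightarrow> (f has_derivative D f x) (at x)"
  using frechet_derivative_works smooth_on_differentiable by blast

lemma linear_D: "smooth_on S f \<Longrightarrow> x \<in> S \<Longrightarrow> linear (D f x)"
  using has_derivative_linear smooth_on_has_derivative by blast

lemma smooth_on_continuous_on: "smooth_on S f \<Longrightarrow> continuous_on S f"
  unfolding smooth_on_def by (metis Ck_on.simps(1))

lemma smooth_on_vecI:
  fixes f :: "'a::euclidean_space \<Rightarrow> real^'n::finite"
  assumes "open S" "\<And>i. smooth_on S (\<lambda>x. f x $ i)"
  shows "smooth_on S f"
proof (rule smooth_on_cong)
  show "smooth_on S (\<lambda>x. \<Sum>i\<in>UNIV. (f x $ i) *\<^sub>R axis i 1 :: real^'n)"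
    by (intro smooth_on_sum smooth_on_scaleR smooth_on_const assms)
qed (metis (no_types, lifting) basis_expansion scalar_mult_eq_scaleR sum.cong)

lemma smooth_on_det:
  fixes F :: "'a::euclidean_space \<Rightarrow> real^'n^'n::finite"
  assumes "open S" "\<And>i j. smooth_on S (\<lambda>x. F x $ i $ j)"
  shows "smooth_on S (\<lambda>x. det (F x))"
  unfolding det_def by (intro smooth_on_sum smooth_on_mult smooth_on_const smooth_on_prod assms)

lemma matrix_inv_inverse:
  fixes B :: "real^'n^'n"
  assumes "invertible B"
  shows "B ** matrix_inv B = mat 1" "matrix_inv B ** B = mat 1"
  using assms unfolding invertible_def matrix_inv_def by (metis (mono_tags, lifting) someI_ex)+

text \<open>By Cramer's rule the entries of the inverse are quotients of determinants. This makes the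
  Christoffel symbols smooth.\<close>

lemma smooth_on_matrix_inv:
  fixes F :: "'a::euclidean_space \<Rightarrow> real^'n^'n::finite"
  assumes S: "open S" and F: "smooth_on S F" and inv: "\<And>x. x \<in> S \<Longrightarrow> invertible (F x)"
  shows "smooth_on S (\<lambda>x. matrix_inv (F x) $ k $ l)"
proof (rule smooth_on_cong)
  let ?A = "\<lambda>x. (\<chi> i j. if j = k then axis l 1 $ i else F x $ i $ j)"
  have d: "det (F x) \<noteq> 0" if "x \<in> S" for x
    using inv[OF that] by (simp add: invertible_det_nz)
  have A: "smooth_on S (\<lambda>x. ?A x $ i $ j)" for i j
    using smooth_on_nth[OF smooth_on_nth[OF F]] S by (cases "j = k") (auto intro: smooth_on_const)
  then show "smooth_on S (\<lambda>x. det (?A x) * inverse (det (F x)))"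
    using d by (intro smooth_on_mult smooth_on_inverse smooth_on_det[OF S A] smooth_on_det[OF S smooth_on_nth[OF smooth_on_nth[OF F]]])
  fix x assume x: "x \<in> S"
  have "F x *v (matrix_inv (F x) *v axis l 1) = axis l 1"
    by (simp add: matrix_vector_mul_assoc matrix_inv_inverse inv x)
  then have "matrix_inv (F x) *v axis l 1 = (\<chi> k. det (\<chi> i j. if j = k then axis l 1 $ i else F x $ i $ j) / det (F x))"
    using cramer[OF d[OF x]] by blast
  then have "(matrix_inv (F x) *v axis l 1) $ k = det (?A x) / det (F x)"
    by simp
  then show "det (?A x) * inverse (det (F x)) = matrix_inv (F x) $ k $ l"
    by (simp add: matrix_vector_mul_component inner_axis divide_inverse)
qed

lemma linear_expand:
  fixes L :: "real^'n::finite \<Rightarrow> 'b::real_vector"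
  assumes "linear L"
  shows "L v = (\<Sum>i\<in>UNIV. (v $ i) *\<^sub>R L (axis i 1))"
proof -
  have "L v = L (\<Sum>i\<in>UNIV. v $ i *\<^sub>R axis i 1)"
    by (simp add: basis_expansion[of v, unfolded scalar_mult_eq_scaleR])
  then show ?thesis
    by (simp add: linear_sum[OF assms] linear_scale[OF assms])
qed

text \<open>The product rule for a vector field \<open>X\<close> inserted into a linear map \<open>L y\<close> that varies with the point.
  It is what differentiates \<open>D Z y (Z y)\<close>, the Christoffel term, and \<open>D \<tau> y (Z y)\<close>: the derivatives of
  \<open>L\<close> are only known for a fixed argument, and expanding \<open>X y\<close> in the standard basis reduces to that case.\<close>

lemma has_derivative_linear_family:
  fixes L :: "'a::euclidean_space \<Rightarrow> real^'n::finite \<Rightarrow> 'b::real_normed_vector"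
  assumes S: "open S" "x \<in> S" and lin: "\<And>y. y \<in> S \<Longrightarrow> linear (L y)"
    and L: "\<And>v. ((\<lambda>y. L y v) has_derivative L' v) (at x)"
    and X: "(X has_derivative X') (at x)"
  shows "((\<lambda>y. L y (X y)) has_derivative (\<lambda>h. L' (X x) h + L x (X' h))) (at x)"
proof -
  let ?F = "\<lambda>y. \<Sum>i\<in>UNIV. (X y $ i) *\<^sub>R L y (axis i 1)"
  have X_nth: "((\<lambda>y. X y $ i) has_derivative (\<lambda>h. X' h $ i)) (at x)" for i
    by (intro bounded_linear.has_derivative[OF bounded_linear_vec_nth] X)
  have "(?F has_derivative (\<lambda>h. \<Sum>i\<in>UNIV. (X x $ i) *\<^sub>R L' (axis i 1) h + (X' h $ i) *\<^sub>R L x (axis i 1))) (at x)"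
    by (intro has_derivative_sum has_derivative_scaleR X_nth L)
  moreover have "(\<Sum>i\<in>UNIV. (X x $ i) *\<^sub>R L' (axis i 1) h + (X' h $ i) *\<^sub>R L x (axis i 1)) = L' (X x) h + L x (X' h)" for h
  proof -
    have "((\<lambda>y. \<Sum>i\<in>UNIV. (X x $ i) *\<^sub>R L y (axis i 1)) has_derivative (\<lambda>h. \<Sum>i\<in>UNIV. (X x $ i) *\<^sub>R L' (axis i 1) h)) (at x)"
      by (intro has_derivative_sum has_derivative_scaleR_right L)
    then have "((\<lambda>y. L y (X x)) has_derivative (\<lambda>h. \<Sum>i\<in>UNIV. (X x $ i) *\<^sub>R L' (axis i 1) h)) (at x)"
      by (rule has_derivative_transform_within_open[OF _ S]) (metis linear_expand[OF lin])
    then have "L' (X x) = (\<lambda>h. \<Sum>i\<in>UNIV. (X x $ i) *\<^sub>R L' (axis i 1) h)"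
      using has_derivative_unique[OF L] by blast
    then show ?thesis
      by (simp add: sum.distrib linear_expand[OF lin[OF S(2)], of "X' h"])
  qed
  ultimately have "(?F has_derivative (\<lambda>h. L' (X x) h + L x (X' h))) (at x)"
    by simp
  then show ?thesis
    by (rule has_derivative_transform_within_open[OF _ S]) (metis linear_expand[OF lin])
qed

lemma mvt_along_segment:
  fixes f :: "'a::euclidean_space \<Rightarrow> real"
  assumes "0 < h" and der: "\<And>t. 0 \<le> t \<Longrightarrow> t \<le> h \<Longrightarrow> (f has_derivative f' (y + t *\<^sub>R u)) (at (y + t *\<^sub>R u))"
  obtains t where "0 < t" "t < h" "f (y + h *\<^sub>R u) - f y = h * f' (y + t *\<^sub>R u) u"
proof -
  have 1: "((\<lambda>t. f (y + t *\<^sub>R u)) has_derivative (\<lambda>s. f' (y + t *\<^sub>R u) (s *\<^sub>R u))) (at t)"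
    if "0 \<le> t" "t \<le> h" for t
    by (rule has_derivative_compose[where f = "\<lambda>t. y + t *\<^sub>R u" and f' = "\<lambda>s. s *\<^sub>R u", OF _ der[OF that]])
      (auto intro!: derivative_eq_intros)
  have "\<exists>t\<in>{0<..<h}. f (y + h *\<^sub>R u) - f (y + 0 *\<^sub>R u) = f' (y + t *\<^sub>R u) ((h - 0) *\<^sub>R u)"
    by (rule mvt_simple[OF assms(1) has_derivative_at_withinI[OF 1]])
  then obtain t where t: "t \<in> {0<..<h}" "f (y + h *\<^sub>R u) - f (y + 0 *\<^sub>R u) = f' (y + t *\<^sub>R u) ((h - 0) *\<^sub>R u)"
    by blast
  have "linear (f' (y + t *\<^sub>R u))"
    by (intro has_derivative_linear[OF der]) (use t(1) in auto)
  then show thesis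
    using t(1) t(2)[symmetric] by (intro that[of t]) (auto simp: linear_scale)
qed

text \<open>The mean value theorem, first in direction \<open>u\<close> and then in direction \<open>v\<close>. The left-hand side does not
  change when \<open>u\<close> and \<open>v\<close> are exchanged, which forces the two mixed second derivatives to agree in the limit.\<close>

lemma second_difference:
  fixes f :: "'a::euclidean_space \<Rightarrow> real"
  assumes f: "smooth_on S f" and h: "0 < h"
    and S: "\<And>s t. 0 \<le> s \<Longrightarrow> s \<le> h \<Longrightarrow> 0 \<le> t \<Longrightarrow> t \<le> h \<Longrightarrow> x + s *\<^sub>R u + t *\<^sub>R v \<in> S"
  obtains s t where "0 < s" "s < h" "0 < t" "t < h"
    "f (x + h *\<^sub>R u + h *\<^sub>R v) - f (x + h *\<^sub>R u) - f (x + h *\<^sub>R v) + f x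
      = h * h * D (\<lambda>y. D f y u) (x + s *\<^sub>R u + t *\<^sub>R v) v"
proof -
  define k where "k y = f (y + h *\<^sub>R v) - f y" for y
  have k: "(k has_derivative (\<lambda>w. D f (y + h *\<^sub>R v) w - D f y w)) (at y)" if "y \<in> S" "y + h *\<^sub>R v \<in> S" for y
    unfolding k_def
    by (intro has_derivative_diff smooth_on_has_derivative[OF f that(1)]
        has_derivative_compose[where f = "\<lambda>y. y + h *\<^sub>R v" and f' = "\<lambda>w. w", OF _ smooth_on_has_derivative[OF f that(2)]])
      (auto intro!: derivative_eq_intros)
  obtain s where s: "0 < s" "s < h"
      "k (x + h *\<^sub>R u) - k x = h * (D f (x + s *\<^sub>R u + h *\<^sub>R v) u - D f (x + s *\<^sub>R u) u)"
  proof (rule mvt_along_segment[OF h, of k "\<lambda>y w. D f (y + h *\<^sub>R v) w - D f y w" x u])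
    fix s assume "0 \<le> s" "s \<le> h"
    then show "(k has_derivative (\<lambda>w. D f (x + s *\<^sub>R u + h *\<^sub>R v) w - D f (x + s *\<^sub>R u) w)) (at (x + s *\<^sub>R u))"
      using S[of s 0] S[of s h] h by (intro k) auto
  qed
  obtain t where t: "0 < t" "t < h"
      "D f (x + s *\<^sub>R u + h *\<^sub>R v) u - D f (x + s *\<^sub>R u) u = h * D (\<lambda>y. D f y u) (x + s *\<^sub>R u + t *\<^sub>R v) v"
    by (rule mvt_along_segment[OF h, of "\<lambda>y. D f y u" "D (\<lambda>y. D f y u)" "x + s *\<^sub>R u" v])
      (use s S[of s] in \<open>auto intro!: smooth_on_has_derivative[OF smooth_on_D[OF f]]\<close>)
  show thesis
    using s t by (intro that[of s t]) (auto simp: k_def algebra_simps)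
qed

lemma second_derivative_symmetric_real:
  fixes f :: "'a::euclidean_space \<Rightarrow> real"
  assumes f: "smooth_on S f" and x: "x \<in> S"
  shows "D (\<lambda>y. D f y u) x v = D (\<lambda>y. D f y v) x u"
proof (rule ccontr)
  define p q where "p y = D (\<lambda>y. D f y u) y v" and "q y = D (\<lambda>y. D f y v) y u" for y
  assume "\<not> ?thesis"
  then have e: "\<bar>p x - q x\<bar> / 2 > 0" (is "?e > 0") by (simp add: p_def q_def)
  have S: "open S" using f by (simp add: smooth_on_def)
  have "isCont p x" "isCont q x"
    using smooth_on_continuous_on[OF smooth_on_D[OF smooth_on_D[OF f]]] S x
    by (auto simp: p_def[abs_def] q_def[abs_def] continuous_on_eq_continuous_at)
  then obtain d1 d2 where d1: "d1 > 0" "\<And>y. dist y x < d1 \<Longrightarrow> dist (p y) (p x) < ?e"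
    and d2: "d2 > 0" "\<And>y. dist y x < d2 \<Longrightarrow> dist (q y) (q x) < ?e"
    using e unfolding continuous_at_eps_delta by metis
  obtain d3 where d3: "d3 > 0" "\<And>y. dist y x < d3 \<Longrightarrow> y \<in> S"
    using S x by (meson open_dist)
  define d where "d = min d1 (min d2 d3)"
  \<comment> \<open>The step is so short that the parallelogram spanned by \<open>h u\<close> and \<open>h v\<close> stays in the ball of radius \<open>d\<close>.\<close>
  define h where "h = d / (2 * (norm u + norm v + 1))"
  have d0: "d > 0" using d1 d2 d3 by (simp add: d_def)
  have n0: "norm u + norm v + 1 > 0" by (smt (verit) norm_ge_zero)
  have h0: "h > 0" using d0 n0 by (simp add: h_def)
  have near: "dist (x + s *\<^sub>R u + t *\<^sub>R v) x < d" if "0 \<le> s" "s \<le> h" "0 \<le> t" "t \<le> h" for s t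
  proof -
    have "dist (x + s *\<^sub>R u + t *\<^sub>R v) x \<le> norm (s *\<^sub>R u) + norm (t *\<^sub>R v)"
      using norm_triangle_ineq[of "s *\<^sub>R u" "t *\<^sub>R v"] by (simp add: dist_norm add.assoc)
    also have "\<dots> \<le> h * norm u + h * norm v"
      using that by (intro add_mono) (auto intro: mult_right_mono)
    also have "\<dots> < h * (norm u + norm v + 1)" using h0 by (simp add: distrib_left)
    also have "\<dots> = d / 2" using n0 by (simp add: h_def field_simps)
    also have "\<dots> < d" using d0 by simp
    finally show ?thesis .
  qed
  have near': "dist (x + s *\<^sub>R v + t *\<^sub>R u) x < d" if "0 \<le> s" "s \<le> h" "0 \<le> t" "t \<le> h" for s t
    using near[of t s] that by (simp add: algebra_simps)
  obtain s t where st: "0 < s" "s < h" "0 < t" "t < h"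
    "f (x + h *\<^sub>R u + h *\<^sub>R v) - f (x + h *\<^sub>R u) - f (x + h *\<^sub>R v) + f x = h * h * p (x + s *\<^sub>R u + t *\<^sub>R v)"
    unfolding p_def using second_difference[OF f h0, of x u v] near d3(2) d_def by auto
  obtain s' t' where st': "0 < s'" "s' < h" "0 < t'" "t' < h"
    "f (x + h *\<^sub>R v + h *\<^sub>R u) - f (x + h *\<^sub>R v) - f (x + h *\<^sub>R u) + f x = h * h * q (x + s' *\<^sub>R v + t' *\<^sub>R u)"
    unfolding q_def using second_difference[OF f h0, of x v u] near' d3(2) d_def by auto
  have "h * h * p (x + s *\<^sub>R u + t *\<^sub>R v) = h * h * q (x + s' *\<^sub>R v + t' *\<^sub>R u)"
    using st(5) st'(5) by (simp add: algebra_simps)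
  then have "p (x + s *\<^sub>R u + t *\<^sub>R v) = q (x + s' *\<^sub>R v + t' *\<^sub>R u)"
    using h0 by simp
  moreover have "dist (p (x + s *\<^sub>R u + t *\<^sub>R v)) (p x) < ?e"
    using near[of s t] st by (intro d1(2)) (auto simp: d_def)
  moreover have "dist (q (x + s' *\<^sub>R v + t' *\<^sub>R u)) (q x) < ?e"
    using near'[of s' t'] st' by (intro d2(2)) (auto simp: d_def)
  ultimately have "\<bar>p x - q x\<bar> < ?e + ?e"
    unfolding dist_real_def by linarith
  then show False by simp
qed

lemma D_nth: "smooth_on S f \<Longrightarrow> x \<in> S \<Longrightarrow> D (\<lambda>y. f y $ i) x v = D f x v $ i"
  by (simp add: D_eqI[OF bounded_linear.has_derivative[OF bounded_linear_vec_nth smooth_on_has_derivative]])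

lemma second_derivative_symmetric:
  fixes f :: "'a::euclidean_space \<Rightarrow> real^'n::finite"
  assumes f: "smooth_on S f" and x: "x \<in> S"
  shows "D (\<lambda>y. D f y u) x v = D (\<lambda>y. D f y v) x u"
proof -
  have S: "open S" using f by (simp add: smooth_on_def)
  have "D (\<lambda>y. D f y u) x v $ i = D (\<lambda>y. D (\<lambda>z. f z $ i) y u) x v" for u v i
  proof -
    have "((\<lambda>y. D (\<lambda>z. f z $ i) y u) has_derivative (\<lambda>v. D (\<lambda>y. D f y u) x v $ i)) (at x)"
      by (rule has_derivative_transform_within_open[OF _ S x, of "\<lambda>y. D f y u $ i"])
        (auto simp: D_nth[OF f] intro: bounded_linear.has_derivative[OF bounded_linear_vec_nth]
          smooth_on_has_derivative[OF smooth_on_D[OF f] x])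
    then show ?thesis by (simp add: D_eqI)
  qed
  then show ?thesis
    by (simp add: vec_eq_iff second_derivative_symmetric_real[OF smooth_on_nth[OF f] x])
qed

section \<open>Linear algebra of Gram matrices\<close>

lemma gram_form_axis: "gram_form B (axis i 1) (axis j 1) = B $ i $ j"
  by (simp add: gram_form_def inner_axis' matrix_vector_mul_component inner_axis)

lemma trace_matrix: "trace (matrix f) = (\<Sum>i\<in>UNIV. f (axis i 1) $ i)"
  by (simp add: trace_def matrix_def)

lemma trace_matrix_comp_commute:
  fixes f :: "real^'n \<Rightarrow> real^'m" and k :: "real^'m \<Rightarrow> real^'n"
  assumes "linear f" "linear k"
  shows "trace (matrix (\<lambda>u. f (k u))) = trace (matrix (\<lambda>u. k (f u)))"
  using matrix_compose[OF assms(1,2)] matrix_compose[OF assms(2,1)] trace_mul_sym[of "matrix k" "matrix f"]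
  by (simp add: comp_def)

text \<open>Gram--Schmidt: as long as fewer than \<open>CARD('n)\<close> vectors have been found, some nonzero vector is
  Euclidean-orthogonal to all \<open>B *v e i\<close>, that is, \<open>B\<close>-orthogonal to all \<open>e i\<close>; it only has to be normalized.\<close>

lemma gram_form_orthonormal_family:
  fixes B :: "real^'n^'n::finite"
  assumes sym: "transpose B = B" and pos: "\<And>v. v \<noteq> 0 \<Longrightarrow> gram_form B v v > 0"
  shows "k \<le> CARD('n) \<Longrightarrow> \<exists>e::nat \<Rightarrow> real^'n. \<forall>i<k. \<forall>j<k. gram_form B (e i) (e j) = (if i = j then 1 else 0)"
proof (induction k)
  case 0
  then show ?case by simp
next
  case (Suc k)
  then obtain e :: "nat \<Rightarrow> real^'n" where e: "\<And>i j. i < k \<Longrightarrow> j < k \<Longrightarrow> gram_form B (e i) (e j) = (if i = j then 1 else 0)"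
    by auto
  let ?T = "(\<lambda>i. B *v e i) ` {..<k}"
  have "dim ?T \<le> card ?T" by (rule dim_le_card') simp
  also have "\<dots> \<le> k" using card_image_le[of "{..<k}"] by simp
  also have "\<dots> < DIM(real^'n)" using Suc.prems by simp
  finally obtain v where v: "v \<noteq> 0" "\<And>y. y \<in> span ?T \<Longrightarrow> orthogonal v y"
    using orthogonal_to_subspace_exists by blast
  define r where "r = sqrt (gram_form B v v)"
  have r: "r > 0" "r * r = gram_form B v v" using pos[OF v(1)] by (auto simp: r_def)
  define w where "w = (1 / r) *\<^sub>R v"
  have "gram_form B v (e i) = 0" if "i < k" for i
    using v(2)[of "B *v e i"] that by (auto simp: orthogonal_def gram_form_def intro: span_base)
  then have we: "gram_form B w (e i) = 0" "gram_form B (e i) w = 0" if "i < k" for i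
    using that gram_form_sym[OF sym, of w "e i"] by (auto simp: w_def gram_form_def)
  have ww: "gram_form B w w = 1"
    using r by (simp add: w_def gram_form_def matrix_vector_mult_scaleR flip: r(2)[unfolded gram_form_def])
  show ?case
    by (rule exI[of _ "e(k := w)"]) (auto simp: less_Suc_eq e we ww)
qed

lemma gram_matrix_orthonormalize:
  fixes B :: "real^'n^'n::finite"
  assumes sym: "transpose B = B" and pos: "\<And>v. v \<noteq> 0 \<Longrightarrow> gram_form B v v > 0"
  obtains P :: "real^'n^'n" where "transpose P ** B ** P = mat 1"
proof -
  obtain e :: "nat \<Rightarrow> real^'n" where e: "\<And>i j. i < CARD('n) \<Longrightarrow> j < CARD('n) \<Longrightarrow> gram_form B (e i) (e j) = (if i = j then 1 else 0)"
    using gram_form_orthonormal_family[OF assms order_refl] by auto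
  obtain f :: "'n \<Rightarrow> nat" where f: "bij_betw f UNIV {0..<CARD('n)}"
    using ex_bij_betw_finite_nat[of "UNIV :: 'n set"] by auto
  define P :: "real^'n^'n" where "P = (\<chi> i j. e (f j) $ i)"
  have col: "column j P = e (f j)" for j by (simp add: P_def column_def vec_eq_iff)
  have PBP: "(transpose P ** B ** P) $ i $ j = gram_form B (e (f i)) (e (f j))" for i j
    by (simp add: gram_form_def matrix_mul_assoc[symmetric])
      (simp add: matrix_matrix_mult_def matrix_vector_mult_def transpose_def P_def inner_vec_def)
  have "(transpose P ** B ** P) $ i $ j = mat 1 $ i $ j" for i j
  proof -
    have "f i < CARD('n)" "f j < CARD('n)" "f i = f j \<longleftrightarrow> i = j"
      using bij_betwE[OF f] bij_betw_imp_inj_on[OF f] by (auto simp: inj_eq)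
    then show ?thesis using PBP e by (simp add: mat_def)
  qed
  then have "transpose P ** B ** P = mat 1" by (simp add: vec_eq_iff)
  then show thesis by (rule that)
qed

lemma det_gram_matrix_pos:
  fixes B :: "real^'n^'n::finite"
  assumes "transpose B = B" and "\<And>v. v \<noteq> 0 \<Longrightarrow> gram_form B v v > 0"
  shows "det B > 0"
proof -
  obtain P :: "real^'n^'n" where "transpose P ** B ** P = mat 1"
    using gram_matrix_orthonormalize[OF assms] .
  then have "det P * det B * det P = 1"
    by (metis det_I det_mul det_transpose)
  then have "(det P)\<^sup>2 * det B = 1" by (simp add: power2_eq_square mult_ac)
  then show ?thesis by (metis zero_less_mult_pos zero_less_one zero_le_power2 less_eq_real_def mult_zero_left zero_neq_one)
qed

lemma inner_transpose: "(A *v u) \<bullet> w = u \<bullet> (transpose A *v w)" for A :: "real^'n^'m"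
  by (metis dot_lmul_matrix inner_commute transpose_matrix_vector)

text \<open>In a \<open>B\<close>-orthonormal basis a \<open>B\<close>-self-adjoint \<open>S\<close> becomes a symmetric matrix \<open>T\<close>, and the trace of
  \<open>T\<^sup>2\<close> is the sum of the squares of its entries.\<close>

lemma trace_square_self_adjoint_nonneg:
  fixes B :: "real^'n^'n::finite" and S :: "real^'n \<Rightarrow> real^'n"
  assumes sym: "transpose B = B" and pos: "\<And>v. v \<noteq> 0 \<Longrightarrow> gram_form B v v > 0"
    and S: "linear S" and adj: "\<And>u v. gram_form B (S u) v = gram_form B u (S v)"
  shows "0 \<le> trace (matrix (\<lambda>u. S (S u)))"
proof -
  obtain P :: "real^'n^'n" where P: "transpose P ** B ** P = mat 1"
    using gram_matrix_orthonormalize[OF sym pos] .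
  let ?S = "matrix S"
  have P': "P ** (transpose P ** B) = mat 1"
    using P matrix_left_right_inverse by blast
  have SS: "?S *v u = S u" for u
    by (rule fun_cong[OF matrix_vector_mul(2)[OF S]])
  have BS: "B ** ?S = transpose ?S ** B"
  proof -
    have "(B ** ?S) $ i $ j = (transpose ?S ** B) $ i $ j" for i j
    proof -
      have "(B ** ?S) $ i $ j = axis i 1 \<bullet> (B *v (?S *v axis j 1))"
        by (simp add: matrix_vector_mul_assoc inner_axis' matrix_vector_mul_component inner_axis)
      also have "\<dots> = gram_form B (axis i 1) (S (axis j 1))"
        by (simp add: gram_form_def SS)
      also have "\<dots> = gram_form B (S (axis i 1)) (axis j 1)" by (simp add: adj)
      also have "\<dots> = (?S *v axis i 1) \<bullet> (B *v axis j 1)"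
        by (simp add: gram_form_def SS)
      also have "\<dots> = axis i 1 \<bullet> ((transpose ?S ** B) *v axis j 1)"
        by (simp add: inner_transpose flip: matrix_vector_mul_assoc)
      finally show ?thesis
        by (simp add: inner_axis' matrix_vector_mul_component inner_axis)
    qed
    then show ?thesis by (simp add: vec_eq_iff)
  qed
  define T where "T = transpose P ** B ** ?S ** P"
  have "transpose T = transpose P ** (transpose ?S ** transpose B) ** P"
    by (simp add: T_def matrix_transpose_mul matrix_mul_assoc)
  then have "transpose T = T"
    by (simp add: T_def sym BS[symmetric] matrix_mul_assoc)
  then have sT: "T $ i $ j = T $ j $ i" for i j by (metis transpose_def vec_lambda_beta)
  have "trace (matrix (\<lambda>u. S (S u))) = trace (?S ** ?S)"
    using matrix_compose[OF S S] by (simp add: comp_def)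
  also have "\<dots> = trace (T ** T)"
  proof -
    let ?Q = "transpose P ** B"
    have "T ** T = ?Q ** (?S ** (P ** ?Q) ** ?S ** P)"
      by (simp add: T_def matrix_mul_assoc)
    also have "\<dots> = ?Q ** (?S ** ?S ** P)" by (simp only: P' matrix_mul_rid)
    finally have "trace (T ** T) = trace (?S ** ?S ** P ** ?Q)" by (simp only: trace_mul_sym[of ?Q])
    also have "?S ** ?S ** P ** ?Q = ?S ** ?S" by (simp only: P' matrix_mul_rid flip: matrix_mul_assoc)
    finally show ?thesis by simp
  qed
  also have "\<dots> = (\<Sum>i\<in>UNIV. \<Sum>k\<in>UNIV. T $ i $ k * T $ i $ k)"
    unfolding trace_def matrix_matrix_mult_def
    by (simp, intro sum.cong refl arg_cong2[where f = "(*)"] sT)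
  also have "\<dots> \<ge> 0" by (intro sum_nonneg) auto
  finally show ?thesis .
qed

section \<open>Three-dimensional algebra\<close>

lemma alternating_expand_3:
  fixes b :: "real^3 \<Rightarrow> real^3 \<Rightarrow> real"
  assumes b: "\<And>v. linear (b v)" and alt: "\<And>u v. b u v = - b v u"
  shows "b u v = (u $ 1 * v $ 2 - u $ 2 * v $ 1) * b (axis 1 1) (axis 2 1)
      + (u $ 2 * v $ 3 - u $ 3 * v $ 2) * b (axis 2 1) (axis 3 1)
      + (u $ 3 * v $ 1 - u $ 1 * v $ 3) * b (axis 3 1) (axis 1 1)"
proof -
  have b1: "b u v = v $ 1 * b u (axis 1 1) + v $ 2 * b u (axis 2 1) + v $ 3 * b u (axis 3 1)" for u v
    using linear_expand[OF b, of u v] by (simp add: sum_3)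
  have d: "b u u = 0" for u using alt[of u u] by simp
  have b2: "b u (axis i 1) = u $ 1 * b (axis 1 1) (axis i 1) + u $ 2 * b (axis 2 1) (axis i 1) + u $ 3 * b (axis 3 1) (axis i 1)" for u i
    using b1[of "axis i 1" u] alt[of u "axis i 1"] alt[of _ "axis i 1"] by (simp add: algebra_simps)
  show ?thesis
    unfolding b1[of u v] b2[of u]
    using alt[of "axis 2 1" "axis 1 1"] alt[of "axis 3 1" "axis 2 1"] alt[of "axis 1 1" "axis 3 1"]
    by (simp add: d algebra_simps)
qed

text \<open>A 3-form on \<open>\<real>\<^sup>3\<close> is a multiple of the determinant, so a linear map acts on it by its own determinant.\<close>

lemma wedge12_det:
  fixes J :: "real^3 \<Rightarrow> real^3"
  assumes a: "linear a" and b: "\<And>v. linear (b v)" and alt: "\<And>u v. b u v = - b v u"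
  shows "wedge12 a b (J (axis 1 1)) (J (axis 2 1)) (J (axis 3 1))
    = det (matrix J) * wedge12 a b (axis 1 1) (axis 2 1) (axis 3 1)"
proof -
  have a': "a u = u $ 1 * a (axis 1 1) + u $ 2 * a (axis 2 1) + u $ 3 * a (axis 3 1)" for u
    using linear_expand[OF a, of u] by (simp add: sum_3)
  show ?thesis
    unfolding wedge12_def a'[of "J u" for u] alternating_expand_3[OF b alt, of "J u" "J v" for u v] det_3 matrix_def
    by simp algebra
qed

text \<open>Jacobi's formula. Writing \<open>F' h = F x ** X\<close> turns it into a polynomial identity in the entries of
  \<open>F x\<close> and \<open>X\<close>.\<close>

lemma has_derivative_det_3:
  fixes F :: "'a::real_normed_vector \<Rightarrow> real^3^3"
  assumes F: "(F has_derivative F') (at x)" and inv: "invertible (F x)"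
  shows "((\<lambda>y. det (F y)) has_derivative (\<lambda>h. det (F x) * trace (matrix_inv (F x) ** F' h))) (at x)"
proof -
  have nth: "((\<lambda>y. F y $ i $ j) has_derivative (\<lambda>h. F' h $ i $ j)) (at x)" for i j
    by (intro bounded_linear.has_derivative[OF bounded_linear_vec_nth] F)
  let ?A = "F x"
  have F': "F' h = ?A ** (matrix_inv ?A ** F' h)" for h
    by (simp add: matrix_mul_assoc matrix_inv_inverse[OF inv])
  define X where "X h = matrix_inv ?A ** F' h" for h
  have F'_nth: "F' h $ i $ j = ?A $ i $ 1 * X h $ 1 $ j + ?A $ i $ 2 * X h $ 2 $ j + ?A $ i $ 3 * X h $ 3 $ j" for h i j
    by (subst F') (simp add: matrix_matrix_mult_def[of ?A] sum_3 X_def)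
  show ?thesis
    unfolding det_3
    by (rule has_derivative_eq_rhs, (rule derivative_intros nth)+)
      (rule ext, simp add: F'_nth trace_def sum_3 flip: X_def, algebra)
qed

section \<open>Covariant derivative of a vector field in one chart\<close>

lemma linear_christoffel_vec:
  "linear (christoffel_vec G x u)" "linear (\<lambda>u. christoffel_vec G x u v)"
  by (auto simp: linear_iff vec_eq_iff christoffel_vec_def sum.distrib sum_distrib_left algebra_simps)

text \<open>The endomorphism \<open>u \<mapsto> \<nabla>\<^sub>u Z\<close> of the tangent space at \<open>x\<close>.\<close>

definition nabla :: "(real^'n \<Rightarrow> real^'n^'n) \<Rightarrow> (real^'n \<Rightarrow> real^'n) \<Rightarrow> real^'n \<Rightarrow> real^'n \<Rightarrow> real^'n::finite" where
  "nabla G Z x u = D Z x u + christoffel_vec G x u (Z x)"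

definition divergence :: "(real^'n \<Rightarrow> real^'n^'n) \<Rightarrow> (real^'n \<Rightarrow> real^'n) \<Rightarrow> real^'n::finite \<Rightarrow> real" where
  "divergence G Z x = trace (matrix (nabla G Z x))"

definition flat :: "(real^'n \<Rightarrow> real^'n^'n) \<Rightarrow> (real^'n \<Rightarrow> real^'n) \<Rightarrow> real^'n::finite \<Rightarrow> real^'n \<Rightarrow> real" where
  "flat G Z x v = gram_form (G x) (Z x) v"

lemma cov_deriv_eq_nabla: "cov_deriv G X Z x = nabla G Z x (X x)"
  by (simp add: cov_deriv_def nabla_def christoffel_vec_def)

lemma curvature_const:
  "curvature G (\<lambda>_. u) (\<lambda>_. v) (\<lambda>_. w) x =
    D (\<lambda>y. christoffel_vec G y v w) x u + christoffel_vec G x u (christoffel_vec G x v w)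
    - D (\<lambda>y. christoffel_vec G y u w) x v - christoffel_vec G x v (christoffel_vec G x u w)"
proof -
  have c: "cov_deriv G (\<lambda>_. v) (\<lambda>_. w) = (\<lambda>y. christoffel_vec G y v w)" for v w
    by (simp add: cov_deriv_eq_nabla nabla_def fun_eq_iff)
  show ?thesis
    unfolding curvature_def c cov_deriv_eq_nabla
    by (simp add: nabla_def lie_bracket_def linear_0[OF linear_christoffel_vec(2)])
qed

lemma linear_gram_form: "linear (gram_form B u)" "linear (\<lambda>u. gram_form B u v)"
  by (auto simp: linear_iff gram_form_def matrix_vector_right_distrib inner_add_right inner_add_left matrix_vector_mult_scaleR)

context
  fixes U :: "(real^'n::finite) set" and G :: "real^'n \<Rightarrow> real^'n^'n"
  assumes metric: "metric_on U G"
begin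

lemma smooth_metric: "smooth_on U G" and open_U: "open U"
  using metric by (auto simp: metric_on_def smooth_on_def)

lemma gram_form_eqI:
  assumes x: "x \<in> U" and "\<And>w. gram_form (G x) u w = gram_form (G x) v w"
  shows "u = v"
proof (rule ccontr)
  assume "u \<noteq> v"
  then have "gram_form (G x) (u - v) (u - v) > 0"
    by (intro metric_on_pos[OF metric x]) simp
  then show False by (simp add: gram_form_diff_left assms(2))
qed

lemma christoffel_vec_symmetric:
  assumes x: "x \<in> U"
  shows "christoffel_vec G x u v = christoffel_vec G x v u"
  using cov_deriv_torsion_free[OF metric x, of "\<lambda>_. u" "\<lambda>_. v"]
  by (simp add: lie_bracket_def cov_deriv_eq_nabla nabla_def)

text \<open>Metric compatibility of the connection, applied to constant fields.\<close>

lemma christoffel_vec_metric: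
  assumes x: "x \<in> U"
  shows "gram_form (D G x u) v w = gram_form (G x) (christoffel_vec G x u v) w + gram_form (G x) v (christoffel_vec G x u w)"
proof -
  have "((\<lambda>y. gram_form (G y) v w) has_derivative (\<lambda>h. gram_form (D G x h) v w)) (at x)"
    using gram_form_has_derivative[OF metric_on_deriv[OF metric x] has_derivative_const has_derivative_const]
    by (simp add: gram_form_def)
  then show ?thesis
    using cov_deriv_metric[OF metric x, of "\<lambda>_. v" "\<lambda>_. w" "\<lambda>_. u"]
    by (simp add: D_eqI cov_deriv_eq_nabla nabla_def)
qed

lemma smooth_christoffel: "smooth_on U (\<lambda>x. christoffel G x k i j)"
  unfolding christoffel_def partial_deriv_def
  by (intro smooth_on_mult smooth_on_sum smooth_on_add smooth_on_diff smooth_on_D smooth_on_nth smooth_metric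
      smooth_on_const open_U smooth_on_matrix_inv metric_on_invertible[OF metric])

lemma smooth_christoffel_vec:
  assumes "smooth_on U X" "smooth_on U Y"
  shows "smooth_on U (\<lambda>x. christoffel_vec G x (X x) (Y x))"
  by (rule smooth_on_vecI[OF open_U])
    (simp add: christoffel_vec_def, intro smooth_on_mult smooth_on_sum smooth_on_nth smooth_christoffel open_U assms)

lemma smooth_gram_form:
  assumes "smooth_on U X" "smooth_on U Y"
  shows "smooth_on U (\<lambda>x. gram_form (G x) (X x) (Y x))"
  unfolding gram_form_def inner_vec_def matrix_vector_mult_def
  by (simp, intro smooth_on_mult smooth_on_sum smooth_on_nth smooth_metric open_U assms)

context
  fixes Z :: "real^'n \<Rightarrow> real^'n"
  assumes Z: "smooth_on U Z"
begin

lemma linear_nabla: "x \<in> U \<Longrightarrow> linear (nabla G Z x)"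
  unfolding nabla_def[abs_def] by (intro linear_compose_add linear_D[OF Z] linear_christoffel_vec)

lemma smooth_nabla: "smooth_on U (\<lambda>x. nabla G Z x u)"
  unfolding nabla_def by (intro smooth_on_add smooth_on_D Z smooth_christoffel_vec smooth_on_const open_U)

lemma smooth_divergence: "smooth_on U (divergence G Z)"
  unfolding divergence_def[abs_def] trace_matrix
  by (intro smooth_on_sum open_U smooth_on_nth smooth_nabla)

lemma smooth_flat: "smooth_on U (\<lambda>x. flat G Z x v)"
  unfolding flat_def by (intro smooth_gram_form Z smooth_on_const open_U)

text \<open>The trace of the Riccati equation \<open>\<nabla>\<^sub>Z S + S\<^sup>2 + R(\<cdot>,Z)Z = 0\<close> for \<open>S = \<nabla>Z\<close>. The equation follows by
  differentiating \<open>\<nabla>\<^sub>Z Z = 0\<close> in direction \<open>u\<close> and exchanging the order of the derivatives, which produces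
  the curvature. In coordinates it holds up to the commutator of \<open>D Z x\<close> with \<open>\<Gamma>(\<cdot>,Z)\<close>, because the
  derivative of the trace is the plain derivative of the entries; a commutator has trace zero.\<close>

lemma divergence_riccati:
  assumes geo: "\<And>y. y \<in> U \<Longrightarrow> nabla G Z y (Z y) = 0" and x: "x \<in> U"
  shows "D (divergence G Z) x (Z x)
    = - trace (matrix (\<lambda>u. nabla G Z x (nabla G Z x u))) - ricci G x (Z x) (Z x)"
proof -
  define z where "z = Z x"
  define dZ where "dZ = D Z x"
  define \<Gamma> where "\<Gamma> = christoffel_vec G x"
  define d2Z where "d2Z u h = D (\<lambda>y. D Z y u) x h" for u h
  define d\<Gamma> where "d\<Gamma> u v h = D (\<lambda>y. christoffel_vec G y u v) x h" for u v h
  have lin: "linear dZ" "linear (\<Gamma> u)" "linear (\<lambda>u. \<Gamma> u v)" for u v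
    by (simp_all add: dZ_def \<Gamma>_def linear_D[OF Z x] linear_christoffel_vec)
  note add = linear_add[OF lin(1)] linear_add[OF lin(2)] linear_add[OF lin(3)]
  have sym: "\<Gamma> u v = \<Gamma> v u" for u v
    by (simp add: \<Gamma>_def christoffel_vec_symmetric[OF x])
  have hZ: "(Z has_derivative dZ) (at x)"
    unfolding dZ_def by (rule smooth_on_has_derivative[OF Z x])
  have hdZ: "((\<lambda>y. D Z y u) has_derivative d2Z u) (at x)" for u
    unfolding d2Z_def[abs_def] by (rule smooth_on_has_derivative[OF smooth_on_D[OF Z] x])
  have h\<Gamma>: "((\<lambda>y. christoffel_vec G y u v) has_derivative d\<Gamma> u v) (at x)" for u v
    unfolding d\<Gamma>_def[abs_def]
    by (rule smooth_on_has_derivative[OF smooth_christoffel_vec[OF smooth_on_const[OF open_U] smooth_on_const[OF open_U]] x])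
  have h\<Gamma>1: "((\<lambda>y. christoffel_vec G y u (Z y)) has_derivative (\<lambda>h. d\<Gamma> u z h + \<Gamma> u (dZ h))) (at x)" for u
    unfolding z_def \<Gamma>_def by (rule has_derivative_linear_family[OF open_U x linear_christoffel_vec(1) h\<Gamma> hZ])
  have h\<Gamma>2: "((\<lambda>y. christoffel_vec G y (Z y) v) has_derivative (\<lambda>h. d\<Gamma> z v h + \<Gamma> (dZ h) v)) (at x)" for v
    unfolding z_def \<Gamma>_def
    by (rule has_derivative_linear_family[OF open_U x linear_christoffel_vec(2) h\<Gamma> hZ, of v])
  have h\<Gamma>3: "((\<lambda>y. christoffel_vec G y (Z y) (Z y)) has_derivative
      (\<lambda>h. (d\<Gamma> z z h + \<Gamma> (dZ h) z) + \<Gamma> z (dZ h))) (at x)"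
    using has_derivative_linear_family[OF open_U x linear_christoffel_vec(1) h\<Gamma>2 hZ]
    by (simp add: z_def \<Gamma>_def)
  have hdZZ: "((\<lambda>y. D Z y (Z y)) has_derivative (\<lambda>h. d2Z z h + dZ (dZ h))) (at x)"
    unfolding z_def dZ_def by (rule has_derivative_linear_family[OF open_U x linear_D[OF Z] hdZ hZ[unfolded dZ_def]])
  have "((\<lambda>y. nabla G Z y (Z y)) has_derivative
      (\<lambda>h. (d2Z z h + dZ (dZ h)) + ((d\<Gamma> z z h + \<Gamma> (dZ h) z) + \<Gamma> z (dZ h)))) (at x)"
    unfolding nabla_def by (intro has_derivative_add hdZZ h\<Gamma>3)
  moreover have "((\<lambda>y. nabla G Z y (Z y)) has_derivative (\<lambda>h. 0)) (at x)"
    by (rule has_derivative_transform_within_open[OF has_derivative_const[of 0] open_U x]) (simp add: geo)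
  \<comment> \<open>The derivative of the geodesic equation in direction \<open>h\<close>.\<close>
  ultimately have geo': "(d2Z z h + dZ (dZ h)) + ((d\<Gamma> z z h + \<Gamma> (dZ h) z) + \<Gamma> z (dZ h)) = 0" for h
    using has_derivative_unique by (metis (no_types, lifting))
  have dZz: "dZ z = - \<Gamma> z z"
    using geo[OF x] by (simp add: nabla_def dZ_def z_def \<Gamma>_def eq_neg_iff_add_eq_0)
  have d2sym: "d2Z u v = d2Z v u" for u v
    unfolding d2Z_def by (rule second_derivative_symmetric[OF Z x])
  have nab: "nabla G Z x u = dZ u + \<Gamma> u z" for u
    by (simp add: nabla_def dZ_def \<Gamma>_def z_def)
  have "((\<lambda>y. nabla G Z y u) has_derivative (\<lambda>h. d2Z u h + (d\<Gamma> u z h + \<Gamma> u (dZ h)))) (at x)" for u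
    unfolding nabla_def by (intro has_derivative_add hdZ h\<Gamma>1)
  then have "(divergence G Z has_derivative
      (\<lambda>h. \<Sum>i\<in>UNIV. (d2Z (axis i 1) h + (d\<Gamma> (axis i 1) z h + \<Gamma> (axis i 1) (dZ h))) $ i)) (at x)"
    unfolding divergence_def[abs_def] trace_matrix
    by (intro has_derivative_sum bounded_linear.has_derivative[OF bounded_linear_vec_nth])
  then have div: "D (divergence G Z) x (Z x) =
      (\<Sum>i\<in>UNIV. (d2Z (axis i 1) z + (d\<Gamma> (axis i 1) z z + \<Gamma> (axis i 1) (dZ z))) $ i)"
    by (simp add: D_eqI z_def)
  have R: "ricci G x (Z x) (Z x) =
     (\<Sum>i\<in>UNIV. (d\<Gamma> z z (axis i 1) + \<Gamma> (axis i 1) (\<Gamma> z z) - d\<Gamma> (axis i 1) z z - \<Gamma> z (\<Gamma> (axis i 1) z)) $ i)"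
    unfolding ricci_def trace_matrix curvature_const by (simp add: d\<Gamma>_def \<Gamma>_def z_def)
  have key: "(d2Z u z + (d\<Gamma> u z z + \<Gamma> u (dZ z))) + nabla G Z x (nabla G Z x u)
      + (d\<Gamma> z z u + \<Gamma> u (\<Gamma> z z) - d\<Gamma> u z z - \<Gamma> z (\<Gamma> u z)) = dZ (\<Gamma> u z) - \<Gamma> z (dZ u)" for u
  proof -
    have e: "d2Z z u = - (dZ (dZ u) + ((d\<Gamma> z z u + \<Gamma> (dZ u) z) + \<Gamma> z (dZ u)))"
      using geo'[of u] by (simp only: eq_neg_iff_add_eq_0 add.assoc)
    show ?thesis
      unfolding d2sym[of u z] e nab dZz linear_neg[OF lin(2)] add
      by (simp add: sym[of u z] sym[of "dZ u" z] sym[of "\<Gamma> z u" z] algebra_simps)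
  qed
  \<comment> \<open>The right-hand side of \<open>key\<close> is a commutator.\<close>
  have "trace (matrix (\<lambda>u. dZ (\<Gamma> u z))) = trace (matrix (\<lambda>u. \<Gamma> (dZ u) z))"
    using trace_matrix_comp_commute[OF lin(1,3)] .
  then have "(\<Sum>i\<in>UNIV. (dZ (\<Gamma> (axis i 1) z) - \<Gamma> z (dZ (axis i 1))) $ i) = 0"
    by (simp add: trace_matrix sum_subtractf sym[of "dZ u" z for u])
  then show ?thesis
    unfolding div R trace_matrix
    unfolding key[symmetric] by (simp add: sum.distrib sum_subtractf algebra_simps)
qed

lemma nabla_metric:
  assumes x: "x \<in> U" and Y: "smooth_on U Y"
  shows "D (\<lambda>y. gram_form (G y) (Z y) (Y y)) x u = gram_form (G x) (nabla G Z x u) (Y x) + gram_form (G x) (Z x) (nabla G Y x u)"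
  using cov_deriv_metric[OF metric x smooth_on_differentiable[OF Z x] smooth_on_differentiable[OF Y x], of "\<lambda>_. u"]
  by (simp add: cov_deriv_eq_nabla)

text \<open>The Christoffel terms of the two covariant derivatives cancel by symmetry: \<open>d\<eta>\<close> is twice the
  skew-symmetric part of \<open>\<nabla>Z\<close>.\<close>

lemma ext_deriv_flat:
  assumes x: "x \<in> U"
  shows "ext_deriv (flat G Z) x u v = gram_form (G x) (nabla G Z x u) v - gram_form (G x) (nabla G Z x v) u"
proof -
  have "D (\<lambda>y. flat G Z y v) x u = gram_form (G x) (nabla G Z x u) v + gram_form (G x) (Z x) (christoffel_vec G x u v)" for u v
    using nabla_metric[OF x smooth_on_const[OF open_U, of v], of u] by (simp add: flat_def nabla_def)
  then show ?thesis
    by (simp add: ext_deriv_def christoffel_vec_symmetric[OF x, of v u])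
qed

lemma nabla_orthogonal_unit:
  assumes unit: "\<And>y. y \<in> U \<Longrightarrow> gram_form (G y) (Z y) (Z y) = 1" and x: "x \<in> U"
  shows "gram_form (G x) (nabla G Z x u) (Z x) = 0"
proof -
  have "((\<lambda>y. gram_form (G y) (Z y) (Z y)) has_derivative (\<lambda>h. 0)) (at x)"
    by (rule has_derivative_transform_within_open[OF has_derivative_const[of 1] open_U x]) (simp add: unit)
  then show ?thesis
    using nabla_metric[OF x Z, of u] gram_form_sym[OF metric_on_sym[OF metric x], of "Z x"] by (simp add: D_eqI)
qed

text \<open>This expresses that \<open>div Z\<close> exceeds the coordinate divergence by half the logarithmic derivative of
  \<open>det G\<close> along \<open>Z\<close>. Metric compatibility reads \<open>D\<^sub>Z G = C\<^sup>T G + G C\<close> with \<open>C = \<Gamma>(Z,\<cdot>)\<close>, and both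
  terms contribute the trace of \<open>C\<close>.\<close>

lemma trace_metric_derivative:
  assumes x: "x \<in> U"
  shows "trace (matrix_inv (G x) ** D G x (Z x)) = 2 * (divergence G Z x - trace (matrix (D Z x)))"
proof -
  let ?C = "matrix (christoffel_vec G x (Z x))"
  have C: "?C *v u = christoffel_vec G x (Z x) u" for u
    by (rule fun_cong[OF matrix_vector_mul(2)[OF linear_christoffel_vec(1)]])
  have inv: "invertible (G x)" by (rule metric_on_invertible[OF metric x])
  have "D G x (Z x) $ i $ j = (transpose ?C ** G x + G x ** ?C) $ i $ j" for i j
  proof -
    have "gram_form (transpose ?C ** G x) u v = gram_form (G x) (?C *v u) v" for u v
      by (simp add: gram_form_def inner_transpose flip: matrix_vector_mul_assoc)
    moreover have "gram_form (G x ** ?C) u v = gram_form (G x) u (?C *v v)" for u v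
      by (simp add: gram_form_def matrix_vector_mul_assoc[symmetric])
    moreover have "gram_form (B + B') u v = gram_form B u v + gram_form B' u v" for B B' :: "real^'n^'n" and u v
      by (simp add: gram_form_def matrix_vector_mult_add_rdistrib inner_add_right)
    ultimately show ?thesis
      unfolding gram_form_axis[symmetric] by (simp add: christoffel_vec_metric[OF x] C)
  qed
  then have "D G x (Z x) = transpose ?C ** G x + G x ** ?C" by (simp add: vec_eq_iff)
  then have "trace (matrix_inv (G x) ** D G x (Z x)) = trace (matrix_inv (G x) ** (transpose ?C ** G x)) + trace ?C"
    by (simp add: matrix_add_ldistrib trace_add matrix_mul_assoc matrix_inv_inverse[OF inv])
  also have "trace (matrix_inv (G x) ** (transpose ?C ** G x)) = trace (transpose ?C)"
    by (subst trace_mul_sym) (simp add: matrix_inv_inverse[OF inv] flip: matrix_mul_assoc)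
  also have "\<dots> = trace ?C" by (simp add: trace_def transpose_def)
  also have "trace ?C = divergence G Z x - trace (matrix (D Z x))"
    by (simp add: divergence_def trace_matrix nabla_def sum.distrib christoffel_vec_symmetric[OF x, of "Z x"])
  finally show ?thesis by simp
qed

end
end

section \<open>Geodesic unit fields in dimension three\<close>

text \<open>The coefficient of \<open>\<eta> \<and> d\<eta>\<close> with respect to \<open>dx\<^sup>1 \<and> dx\<^sup>2 \<and> dx\<^sup>3\<close>. Under a change of coordinates it picks
  up a Jacobian determinant.\<close>

definition contact_density :: "(real^3 \<Rightarrow> real^3^3) \<Rightarrow> (real^3 \<Rightarrow> real^3) \<Rightarrow> real^3 \<Rightarrow> real" where
  "contact_density G Z x = wedge12 (flat G Z x) (ext_deriv (flat G Z) x) (axis 1 1) (axis 2 1) (axis 3 1)"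

text \<open>The squared ratio of \<open>\<eta> \<and> d\<eta>\<close> to the Riemannian volume form. Squaring removes the sign that
  depends on the orientation of the chart, so the value does not depend on the chart.\<close>

definition twist_sq :: "(real^3 \<Rightarrow> real^3^3) \<Rightarrow> (real^3 \<Rightarrow> real^3) \<Rightarrow> real^3 \<Rightarrow> real" where
  "twist_sq G Z x = (contact_density G Z x)\<^sup>2 / det (G x)"

lemma ext_deriv_alternating: "ext_deriv \<alpha> x u v = - ext_deriv \<alpha> x v u"
  by (simp add: ext_deriv_def)

lemma linear_ext_deriv_flat:
  fixes U :: "(real^'n::finite) set"
  assumes "metric_on U G" "smooth_on U Z" "x \<in> U"
  shows "linear (ext_deriv (flat G Z) x u)"
proof -
  have "linear (\<lambda>v. gram_form (G x) (nabla G Z x v) u)"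
    using linear_compose[OF linear_nabla[OF assms] linear_gram_form(2)] by (simp add: comp_def)
  then show ?thesis
    unfolding ext_deriv_flat[OF assms, abs_def] by (intro linear_compose_sub linear_gram_form)
qed

context
  fixes U :: "(real^3) set" and G :: "real^3 \<Rightarrow> real^3^3" and Z :: "real^3 \<Rightarrow> real^3"
  assumes metric: "metric_on U G" and Z: "smooth_on U Z"
begin

lemma smooth_contact_density: "smooth_on U (contact_density G Z)"
  unfolding contact_density_def[abs_def] wedge12_def ext_deriv_def
  by (intro smooth_on_add smooth_on_mult smooth_on_diff smooth_on_D smooth_flat[OF metric Z])

lemma det_metric_pos: "x \<in> U \<Longrightarrow> det (G x) > 0"
  by (rule det_gram_matrix_pos[OF metric_on_sym[OF metric] metric_on_pos[OF metric]])

lemma twist_sq_nonneg: "x \<in> U \<Longrightarrow> twist_sq G Z x \<ge> 0"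
  using det_metric_pos[of x] by (simp add: twist_sq_def)

lemma twist_sq_eq_0_iff: "x \<in> U \<Longrightarrow> twist_sq G Z x = 0 \<longleftrightarrow> contact_density G Z x = 0"
  using det_metric_pos[of x] by (simp add: twist_sq_def)

lemma smooth_twist_sq: "smooth_on U (twist_sq G Z)"
  unfolding twist_sq_def[abs_def] power2_eq_square divide_inverse
  by (intro smooth_on_mult smooth_contact_density smooth_on_inverse smooth_on_det open_U[OF metric]
      smooth_on_nth smooth_metric[OF metric])
    (use det_metric_pos in force)

context
  assumes unit: "\<And>y. y \<in> U \<Longrightarrow> gram_form (G y) (Z y) (Z y) = 1"
    and geo: "\<And>y. y \<in> U \<Longrightarrow> nabla G Z y (Z y) = 0"
begin

text \<open>The vector \<open>curl \<eta>\<close> of components of \<open>d\<eta>\<close> spans the kernel of \<open>d\<eta>\<close> where it is not zero. For a geodesic unit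
  field \<open>d\<eta>(Z,\<cdot>) = 0\<close>, hence \<open>curl \<eta>\<close> is a multiple of \<open>Z\<close>; pairing with \<open>\<eta>\<close> identifies the factor.\<close>

lemma curl_flat_eq:
  assumes y: "y \<in> U"
  shows "ext_deriv (flat G Z) y (axis 2 1) (axis 3 1) = contact_density G Z y * Z y $ 1"
    and "ext_deriv (flat G Z) y (axis 3 1) (axis 1 1) = contact_density G Z y * Z y $ 2"
    and "ext_deriv (flat G Z) y (axis 1 1) (axis 2 1) = contact_density G Z y * Z y $ 3"
proof -
  let ?a = "flat G Z y" and ?b = "ext_deriv (flat G Z) y"
  have b0: "?b (Z y) v = 0" for v
    by (simp add: ext_deriv_flat[OF metric Z y] geo[OF y] nabla_orthogonal_unit[OF metric Z unit y])
      (simp add: gram_form_def)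
  note e = alternating_expand_3[OF linear_ext_deriv_flat[OF metric Z y] ext_deriv_alternating, of "Z y"]
  define a1 a2 a3 b12 b23 b31 z1 z2 z3 where "a1 = ?a (axis 1 1)" "a2 = ?a (axis 2 1)" "a3 = ?a (axis 3 1)"
    "b12 = ?b (axis 1 1) (axis 2 1)" "b23 = ?b (axis 2 1) (axis 3 1)" "b31 = ?b (axis 3 1) (axis 1 1)"
    "z1 = Z y $ 1" "z2 = Z y $ 2" "z3 = Z y $ 3"
  note defs = this
  have "linear ?a" unfolding flat_def[abs_def] by (rule linear_gram_form)
  then have "?a (Z y) = z1 * a1 + z2 * a2 + z3 * a3"
    using linear_expand[of ?a "Z y"] by (simp add: sum_3 defs)
  then have u: "z1 * a1 + z2 * a2 + z3 * a3 = 1"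
    by (simp add: flat_def unit[OF y])
  have axis_nth: "(axis i 1 :: real^3) $ j = (if i = j then 1 else 0)" for i j
    by (simp add: axis_def)
  have r: "z3 * b31 = z2 * b12" "z1 * b12 = z3 * b23" "z2 * b23 = z1 * b31"
    using e[of "axis 1 1"] e[of "axis 2 1"] e[of "axis 3 1"]
    by (simp_all add: b0 axis_nth flip: defs)
  have W: "contact_density G Z y = a1 * b23 + a2 * b31 + a3 * b12"
    by (simp add: contact_density_def wedge12_def defs)
  show "?b (axis 2 1) (axis 3 1) = contact_density G Z y * Z y $ 1"
    "?b (axis 3 1) (axis 1 1) = contact_density G Z y * Z y $ 2"
    "?b (axis 1 1) (axis 2 1) = contact_density G Z y * Z y $ 3"
    unfolding W defs[symmetric] using u r by algebra+
qed

text \<open>Since \<open>d(d\<eta>) = 0\<close>, the field \<open>curl \<eta> = W Z\<close> is divergence-free in coordinates, where \<open>W\<close> is the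
  contact density.\<close>

lemma contact_density_transport:
  assumes x: "x \<in> U"
  shows "D (contact_density G Z) x (Z x) = - contact_density G Z x * trace (matrix (D Z x))"
proof -
  let ?W = "contact_density G Z" and ?e = "\<lambda>i::3. axis i 1 :: real^3" and ?\<eta> = "\<lambda>j y. flat G Z y (axis j 1)"
  have der: "D (\<lambda>y. ?W y * Z y $ i) x h = D ?W x h * Z x $ i + ?W x * D Z x h $ i" for i h
  proof -
    have "((\<lambda>y. ?W y * Z y $ i) has_derivative (\<lambda>h. ?W x * D Z x h $ i + D ?W x h * Z x $ i)) (at x)"
      by (intro has_derivative_mult smooth_on_has_derivative[OF smooth_contact_density x]
          bounded_linear.has_derivative[OF bounded_linear_vec_nth] smooth_on_has_derivative[OF Z x])
    then show ?thesis by (simp add: D_eqI)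
  qed
  have curl: "D (\<lambda>y. ext_deriv (flat G Z) y (?e i) (?e j)) x h
      = D (\<lambda>y. D (?\<eta> j) y (?e i)) x h - D (\<lambda>y. D (?\<eta> i) y (?e j)) x h" for i j h
    unfolding ext_deriv_def
    by (simp add: D_eqI[OF has_derivative_diff[OF smooth_on_has_derivative[OF smooth_on_D[OF smooth_flat[OF metric Z]] x]
          smooth_on_has_derivative[OF smooth_on_D[OF smooth_flat[OF metric Z]] x]]])
  have cong: "D (\<lambda>y. ?W y * Z y $ k) x h = D (\<lambda>y. ext_deriv (flat G Z) y (?e i) (?e j)) x h"
    if "\<And>y. y \<in> U \<Longrightarrow> ext_deriv (flat G Z) y (?e i) (?e j) = ?W y * Z y $ k" for i j k h
  proof -
    have "smooth_on U (\<lambda>y. ?W y * Z y $ k)"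
      by (intro smooth_on_mult smooth_contact_density smooth_on_nth Z)
    then have "D (\<lambda>y. ?W y * Z y $ k) x = D (\<lambda>y. ext_deriv (flat G Z) y (?e i) (?e j)) x"
      by (intro frechet_derivative_transform_within_open[OF smooth_on_differentiable[OF _ x] open_U[OF metric] x])
        (simp_all add: that)
    then show ?thesis by simp
  qed
  have sym: "D (\<lambda>y. D (?\<eta> j) y u) x v = D (\<lambda>y. D (?\<eta> j) y v) x u" for j u v
    by (rule second_derivative_symmetric_real[OF smooth_flat[OF metric Z] x])
  \<comment> \<open>\<open>div (curl \<eta>) = 0\<close>, by the symmetry of second derivatives.\<close>
  have "D (\<lambda>y. ?W y * Z y $ 1) x (?e 1) + D (\<lambda>y. ?W y * Z y $ 2) x (?e 2) + D (\<lambda>y. ?W y * Z y $ 3) x (?e 3) = 0"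
    using cong[OF curl_flat_eq(1), of "?e 1"] cong[OF curl_flat_eq(2), of "?e 2"] cong[OF curl_flat_eq(3), of "?e 3"]
      curl[of 2 3 "?e 1"] curl[of 3 1 "?e 2"] curl[of 1 2 "?e 3"]
      sym[of 3 "?e 2" "?e 1"] sym[of 2 "?e 3" "?e 1"] sym[of 1 "?e 3" "?e 2"] by linarith
  moreover have "D ?W x (Z x) = Z x $ 1 * D ?W x (?e 1) + Z x $ 2 * D ?W x (?e 2) + Z x $ 3 * D ?W x (?e 3)"
    using linear_expand[OF linear_D[OF smooth_contact_density x], of "Z x"] by (simp add: sum_3)
  ultimately show ?thesis
    unfolding der trace_matrix sum_3 by (simp add: algebra_simps)
qed

text \<open>The coordinate divergences coming from the density and from \<open>det G\<close> cancel, and the Riemannian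
  divergence remains. So \<open>Z\<close> transports the twist by a linear equation.\<close>

lemma twist_sq_transport:
  assumes x: "x \<in> U"
  shows "D (twist_sq G Z) x (Z x) = - 2 * divergence G Z x * twist_sq G Z x"
proof -
  let ?W = "contact_density G Z" and ?d = "det (G x)"
  let ?t = "\<lambda>h. trace (matrix_inv (G x) ** D G x h)"
  have d: "?d > 0" by (rule det_metric_pos[OF x])
  have hW: "(?W has_derivative D ?W x) (at x)"
    by (rule smooth_on_has_derivative[OF smooth_contact_density x])
  have hd: "((\<lambda>y. det (G y)) has_derivative (\<lambda>h. ?d * ?t h)) (at x)"
    by (rule has_derivative_det_3[OF metric_on_deriv[OF metric x] metric_on_invertible[OF metric x]])
  have "(twist_sq G Z has_derivative (\<lambda>h. (2 * ?W x * D ?W x h * ?d - (?W x)\<^sup>2 * (?d * ?t h)) / (?d * ?d))) (at x)"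
    unfolding twist_sq_def[abs_def] power2_eq_square
    by (rule has_derivative_eq_rhs, rule has_derivative_divide'[OF has_derivative_mult[OF hW hW] hd])
      (use d in \<open>auto simp: algebra_simps\<close>)
  then have "D (twist_sq G Z) x (Z x) = (2 * ?W x * D ?W x (Z x) * ?d - (?W x)\<^sup>2 * (?d * ?t (Z x))) / (?d * ?d)"
    by (simp add: D_eqI)
  also have "\<dots> = - 2 * divergence G Z x * ((?W x)\<^sup>2 / ?d)"
    unfolding contact_density_transport[OF x] trace_metric_derivative[OF metric Z x]
    using d by (simp add: field_simps power2_eq_square)
  finally show ?thesis by (simp add: twist_sq_def)
qed

text \<open>Where \<open>\<eta> \<and> d\<eta>\<close> vanishes, \<open>d\<eta>\<close> vanishes as well, so \<open>\<nabla>Z\<close> is self-adjoint there and its square has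
  nonnegative trace in the Riccati equation.\<close>

lemma divergence_decreasing_if_no_twist:
  assumes x: "x \<in> U" and W: "contact_density G Z x = 0" and ric: "ricci G x (Z x) (Z x) > 0"
  shows "D (divergence G Z) x (Z x) < 0"
proof -
  let ?b = "ext_deriv (flat G Z) x"
  have "?b u v = 0" for u v
    using alternating_expand_3[OF linear_ext_deriv_flat[OF metric Z x] ext_deriv_alternating, of u v]
    by (simp add: curl_flat_eq[OF x] W)
  then have "gram_form (G x) (nabla G Z x u) v = gram_form (G x) u (nabla G Z x v)" for u v
    using ext_deriv_flat[OF metric Z x, of u v] gram_form_sym[OF metric_on_sym[OF metric x], of u] by simp
  then have "0 \<le> trace (matrix (\<lambda>u. nabla G Z x (nabla G Z x u)))"
    by (intro trace_square_self_adjoint_nonneg[OF metric_on_sym[OF metric x] metric_on_pos[OF metric x]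
          linear_nabla[OF metric Z x]])
  then show ?thesis
    using divergence_riccati[OF metric Z geo x] ric by simp
qed

end
end

section \<open>Change of coordinates\<close>

context
  fixes U V O' :: "(real^'n::finite) set" and G H :: "real^'n \<Rightarrow> real^'n^'n"
    and Z Y \<tau> :: "real^'n \<Rightarrow> real^'n"
  assumes G: "metric_on U G" and H: "metric_on V H" and Z: "smooth_on U Z" and Y: "smooth_on V Y"
    and \<tau>: "smooth_on O' \<tau>" and OU: "O' \<subseteq> U" and OV: "\<And>y. y \<in> O' \<Longrightarrow> \<tau> y \<in> V"
    and GH: "\<And>y u v. y \<in> O' \<Longrightarrow> gram_form (H (\<tau> y)) (D \<tau> y u) (D \<tau> y v) = gram_form (G y) u v"
    and ZY: "\<And>y. y \<in> O' \<Longrightarrow> Y (\<tau> y) = D \<tau> y (Z y)"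
begin

text \<open>The Jacobian preserves the metrics and is therefore injective; the dimensions agree.\<close>

lemma jacobian_bij:
  assumes x: "x \<in> O'"
  shows "\<exists>K. linear K \<and> (\<forall>u. K (D \<tau> x u) = u) \<and> (\<forall>v. D \<tau> x (K v) = v)"
proof -
  have J: "linear (D \<tau> x)" by (rule linear_D[OF \<tau> x])
  have xU: "x \<in> U" using x OU by auto
  have "u = 0" if "D \<tau> x u = 0" for u
  proof (rule ccontr)
    assume "u \<noteq> 0"
    then show False using GH[OF x, of u u] metric_on_pos[OF G xU, of u] that by (simp add: gram_form_def)
  qed
  then have "inj (D \<tau> x)" by (simp add: linear_injective_0[OF J])
  then show ?thesis by (rule linear_injective_isomorphism[OF J]) (rule refl)
qed

text \<open>Tensoriality of \<open>\<nabla>Z\<close>. The second derivatives of \<open>\<tau>\<close> enter through the derivative of \<open>Y \<circ> \<tau>\<close> and,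
  by Koszul's formula, through the derivatives of the metric coefficients; as they are symmetric, the
  two contributions cancel.\<close>

lemma nabla_transform:
  assumes x: "x \<in> O'"
  shows "nabla H Y (\<tau> x) (D \<tau> x u) = D \<tau> x (nabla G Z x u)"
proof -
  let ?J = "D \<tau> x" and ?g = "gram_form (H (\<tau> x))"
  define d2 where "d2 u h = D (\<lambda>y. D \<tau> y u) x h" for u h
  have S: "open O'" using \<tau> by (simp add: smooth_on_def)
  have xU: "x \<in> U" and xV: "\<tau> x \<in> V" using x OU OV by auto
  have d2sym: "d2 u v = d2 v u" for u v
    unfolding d2_def by (rule second_derivative_symmetric[OF \<tau> x])
  have h\<tau>: "(\<tau> has_derivative ?J) (at x)" by (rule smooth_on_has_derivative[OF \<tau> x])
  have hd: "((\<lambda>y. D \<tau> y u) has_derivative d2 u) (at x)" for u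
    unfolding d2_def[abs_def] by (rule smooth_on_has_derivative[OF smooth_on_D[OF \<tau>] x])
  have J: "linear ?J" by (rule linear_D[OF \<tau> x])
  have sym: "?g u v = ?g v u" for u v by (rule gram_form_sym[OF metric_on_sym[OF H xV]])
  have M: "gram_form (D G x a) u v = gram_form (D H (\<tau> x) (?J a)) (?J u) (?J v) + ?g (d2 u a) (?J v) + ?g (?J u) (d2 v a)" for a u v
  proof -
    have "((\<lambda>y. gram_form (H (\<tau> y)) (D \<tau> y u) (D \<tau> y v)) has_derivative
        (\<lambda>a. gram_form (D H (\<tau> x) (?J a)) (?J u) (?J v) + ?g (d2 u a) (?J v) + ?g (?J u) (d2 v a))) (at x)"
      by (rule gram_form_has_derivative[OF has_derivative_compose[OF h\<tau> metric_on_deriv[OF H xV]] hd hd])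
    then have "((\<lambda>y. gram_form (G y) u v) has_derivative
        (\<lambda>a. gram_form (D H (\<tau> x) (?J a)) (?J u) (?J v) + ?g (d2 u a) (?J v) + ?g (?J u) (d2 v a))) (at x)"
      by (rule has_derivative_transform_within_open[OF _ S x]) (simp add: GH)
    moreover have "((\<lambda>y. gram_form (G y) u v) has_derivative (\<lambda>a. gram_form (D G x a) u v)) (at x)"
      using gram_form_has_derivative[OF metric_on_deriv[OF G xU] has_derivative_const has_derivative_const]
      by (simp add: gram_form_def)
    ultimately show ?thesis by (metis (no_types, lifting) has_derivative_unique)
  qed
  have V: "D Y (\<tau> x) (?J a) = d2 (Z x) a + ?J (D Z x a)" for a
  proof -
    have "((\<lambda>y. D \<tau> y (Z y)) has_derivative (\<lambda>a. d2 (Z x) a + ?J (D Z x a))) (at x)"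
      by (rule has_derivative_linear_family[OF S x linear_D[OF \<tau>] hd smooth_on_has_derivative[OF Z xU]])
    then have "((\<lambda>y. Y (\<tau> y)) has_derivative (\<lambda>a. d2 (Z x) a + ?J (D Z x a))) (at x)"
      by (rule has_derivative_transform_within_open[OF _ S x]) (simp add: ZY)
    moreover have "((\<lambda>y. Y (\<tau> y)) has_derivative (\<lambda>a. D Y (\<tau> x) (?J a))) (at x)"
      by (rule has_derivative_compose[OF h\<tau> smooth_on_has_derivative[OF Y xV]])
    ultimately show ?thesis by (metis (no_types, lifting) has_derivative_unique)
  qed
  note kG = gram_form_christoffel[OF metric_on_deriv[OF G xU] metric_on_sym[OF G xU] metric_on_invertible[OF G xU]]
  note kH = gram_form_christoffel[OF metric_on_deriv[OF H xV] metric_on_sym[OF H xV] metric_on_invertible[OF H xV]]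
  have eq: "?g (nabla H Y (\<tau> x) (?J u)) (?J w) = ?g (?J (nabla G Z x u)) (?J w)" for w
  proof -
    let ?z = "Z x" and ?h = "D H (\<tau> x)"
    have swap: "?g (?J ?z) (d2 w u) = ?g (d2 u w) (?J ?z)" "?g (?J u) (d2 w ?z) = ?g (?J u) (d2 ?z w)"
        "?g (d2 u ?z) (?J w) = ?g (d2 ?z u) (?J w)"
      by (simp_all only: sym[of "?J ?z"] d2sym[of w u] d2sym[of w ?z] d2sym[of u ?z])
    have "gram_form (D G x u) ?z w + gram_form (D G x ?z) u w - gram_form (D G x w) u ?z
      = gram_form (?h (?J u)) (?J ?z) (?J w) + gram_form (?h (?J ?z)) (?J u) (?J w) - gram_form (?h (?J w)) (?J u) (?J ?z)
        + 2 * ?g (d2 ?z u) (?J w)"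
      unfolding M swap by simp
    then show ?thesis
      unfolding GH[OF x] nabla_def V gram_form_add_left kH ZY[OF x] kG by simp
  qed
  obtain K where K: "?J (K v) = v" for v using jacobian_bij[OF x] by metis
  show ?thesis
  proof (rule gram_form_eqI[OF H xV])
    fix v
    show "?g (nabla H Y (\<tau> x) (?J u)) v = ?g (?J (nabla G Z x u)) v"
      using eq[of "K v"] by (simp only: K)
  qed
qed

lemma divergence_transform:
  assumes x: "x \<in> O'"
  shows "divergence H Y (\<tau> x) = divergence G Z x"
proof -
  let ?J = "D \<tau> x"
  have xU: "x \<in> U" using x OU by auto
  have J: "linear ?J" by (rule linear_D[OF \<tau> x])
  obtain K where K: "linear K" "\<And>u. K (?J u) = u" "\<And>v. ?J (K v) = v"
    using jacobian_bij[OF x] by metis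
  have "nabla H Y (\<tau> x) = (\<lambda>v. ?J (nabla G Z x (K v)))"
    by (metis K(3) nabla_transform[OF x])
  then have "divergence H Y (\<tau> x) = trace (matrix (\<lambda>v. ?J (nabla G Z x (K v))))"
    by (simp add: divergence_def)
  also have "\<dots> = trace (matrix (\<lambda>v. nabla G Z x (K (?J v))))"
    using linear_compose[OF K(1) linear_nabla[OF G Z xU]]
    by (intro trace_matrix_comp_commute J) (simp add: comp_def)
  finally show ?thesis by (simp add: divergence_def K(2))
qed

lemma flat_transform: "x \<in> O' \<Longrightarrow> flat H Y (\<tau> x) (D \<tau> x v) = flat G Z x v"
  by (simp add: flat_def ZY GH)

lemma ext_deriv_flat_transform:
  assumes x: "x \<in> O'"
  shows "ext_deriv (flat H Y) (\<tau> x) (D \<tau> x u) (D \<tau> x v) = ext_deriv (flat G Z) x u v"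
proof -
  have "x \<in> U" "\<tau> x \<in> V" using x OU OV by auto
  then show ?thesis
    by (simp add: ext_deriv_flat[OF G Z] ext_deriv_flat[OF H Y] nabla_transform[OF x] GH[OF x])
qed

lemma divergence_deriv_transform:
  assumes x: "x \<in> O'"
  shows "D (divergence H Y) (\<tau> x) (Y (\<tau> x)) = D (divergence G Z) x (Z x)"
proof -
  have S: "open O'" using \<tau> by (simp add: smooth_on_def)
  have xU: "x \<in> U" and xV: "\<tau> x \<in> V" using x OU OV by auto
  have "((\<lambda>y. divergence H Y (\<tau> y)) has_derivative (\<lambda>a. D (divergence H Y) (\<tau> x) (D \<tau> x a))) (at x)"
    by (rule has_derivative_compose[OF smooth_on_has_derivative[OF \<tau> x]
          smooth_on_has_derivative[OF smooth_divergence[OF H Y] xV]])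
  then have "(divergence G Z has_derivative (\<lambda>a. D (divergence H Y) (\<tau> x) (D \<tau> x a))) (at x)"
    by (rule has_derivative_transform_within_open[OF _ S x]) (rule divergence_transform)
  then show ?thesis by (simp add: D_eqI ZY[OF x])
qed

end

text \<open>The contact density and the volume density \<open>sqrt (det G)\<close> scale by the same Jacobian determinant up to sign.\<close>

lemma twist_sq_transform:
  fixes U V O' :: "(real^3) set"
  assumes G: "metric_on U G" and H: "metric_on V H" and Z: "smooth_on U Z" and Y: "smooth_on V Y"
    and \<tau>: "smooth_on O' \<tau>" and OU: "O' \<subseteq> U" and OV: "\<And>y. y \<in> O' \<Longrightarrow> \<tau> y \<in> V"
    and GH: "\<And>y u v. y \<in> O' \<Longrightarrow> gram_form (H (\<tau> y)) (D \<tau> y u) (D \<tau> y v) = gram_form (G y) u v"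
    and ZY: "\<And>y. y \<in> O' \<Longrightarrow> Y (\<tau> y) = D \<tau> y (Z y)"
    and x: "x \<in> O'"
  shows "twist_sq H Y (\<tau> x) = twist_sq G Z x"
proof -
  let ?J = "D \<tau> x"
  have xU: "x \<in> U" and xV: "\<tau> x \<in> V" using x OU OV by auto
  have J: "matrix ?J *v u = ?J u" for u
    by (rule fun_cong[OF matrix_vector_mul(2)[OF linear_D[OF \<tau> x]]])
  have "G x $ i $ j = (transpose (matrix ?J) ** H (\<tau> x) ** matrix ?J) $ i $ j" for i j
    unfolding gram_form_axis[symmetric] GH[OF x, symmetric]
    by (simp add: gram_form_def J[symmetric] inner_transpose matrix_vector_mul_assoc matrix_mul_assoc)
  then have "G x = transpose (matrix ?J) ** H (\<tau> x) ** matrix ?J" by (simp add: vec_eq_iff)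
  then have det: "det (G x) = (det (matrix ?J))\<^sup>2 * det (H (\<tau> x))"
    by (simp add: det_mul det_transpose power2_eq_square)
  have "contact_density G Z x = wedge12 (flat H Y (\<tau> x)) (ext_deriv (flat H Y) (\<tau> x)) (?J (axis 1 1)) (?J (axis 2 1)) (?J (axis 3 1))"
    by (simp add: contact_density_def wedge12_def flat_transform[OF G H Z Y \<tau> OU OV GH ZY x]
        ext_deriv_flat_transform[OF G H Z Y \<tau> OU OV GH ZY x])
  also have "\<dots> = det (matrix ?J) * contact_density H Y (\<tau> x)"
    unfolding contact_density_def flat_def[of H Y "\<tau> x", abs_def]
    by (intro wedge12_det linear_gram_form linear_ext_deriv_flat[OF H Y xV] ext_deriv_alternating)
  finally have W: "contact_density G Z x = det (matrix ?J) * contact_density H Y (\<tau> x)" .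
  have "det (matrix ?J) \<noteq> 0" using det_metric_pos[OF G Z xU] det by auto
  then show ?thesis by (simp add: twist_sq_def W det power_mult_distrib)
qed

section \<open>Compactness and gluing over the atlas\<close>

lemma compact_space_attains_inf:
  assumes X: "compact_space X" and f: "continuous_map X euclideanreal f" and S: "closedin X S" "S \<noteq> {}"
  obtains q where "q \<in> S" "\<And>p. p \<in> S \<Longrightarrow> f q \<le> f p"
proof -
  have "compactin X S" using X S(1) by (rule closedin_compact_space)
  then have "compact (f ` S)"
    using image_compactin[OF _ f] by (simp add: compactin_euclidean_iff)
  then show thesis
    using compact_attains_inf[of "f ` S"] S(2) that by auto
qed

text \<open>A minimum principle without a flow. Think of \<open>h\<close> as the derivative of \<open>\<theta>\<close> along a vector field that acts on
  \<open>w\<close> by the factor \<open>-2 \<theta>\<close>: the hypothesis on \<open>K\<close> and \<open>q\<close> is then the vanishing of the derivative of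
  \<open>\<theta> + K w\<close> at a minimum. If the zero set \<open>N\<close> of \<open>w\<close> were nonempty, the minimizers of \<open>\<theta> + K w\<close> for large
  \<open>K\<close> would lie close to \<open>N\<close> and have small \<open>K w\<close>. Hence \<open>h = 2 \<theta> K w\<close> would be close to zero there,
  although \<open>h\<close> is bounded away from zero near \<open>N\<close>.\<close>

lemma penalty_positive_on_compact:
  fixes \<theta> w h :: "'a \<Rightarrow> real"
  assumes X: "compact_space X"
    and cont: "continuous_map X euclideanreal \<theta>" "continuous_map X euclideanreal w" "continuous_map X euclideanreal h"
    and w: "\<And>p. p \<in> topspace X \<Longrightarrow> w p \<ge> 0"
    and h: "\<And>p. p \<in> topspace X \<Longrightarrow> w p = 0 \<Longrightarrow> h p < 0"
    and crit: "\<And>K q. q \<in> topspace X \<Longrightarrow> (\<And>p. p \<in> topspace X \<Longrightarrow> \<theta> q + K * w q \<le> \<theta> p + K * w p)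
        \<Longrightarrow> h q = 2 * K * \<theta> q * w q"
    and p: "p \<in> topspace X"
  shows "w p > 0"
proof (rule ccontr)
  assume "\<not> w p > 0"
  then have wp: "w p = 0" using w[OF p] by simp
  define N where "N = {q \<in> topspace X. w q \<in> {0}}"
  have N: "closedin X N"
    unfolding N_def by (rule closedin_continuous_map_preimage[OF cont(2)]) simp
  have Nne: "N \<noteq> {}" using p wp by (auto simp: N_def)
  obtain q0 where q0: "q0 \<in> N" "\<And>p. p \<in> N \<Longrightarrow> \<theta> q0 \<le> \<theta> p"
    using compact_space_attains_inf[OF X cont(1) N Nne] by blast
  have neg: "continuous_map X euclideanreal (\<lambda>p. - h p)" "continuous_map X euclideanreal (\<lambda>p. - \<bar>\<theta> p\<bar>)"
    using cont by (auto intro: continuous_map_minus continuous_map_real_abs)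
  obtain q1 where q1: "q1 \<in> N" "\<And>p. p \<in> N \<Longrightarrow> h p \<le> h q1"
    using compact_space_attains_inf[OF X neg(1) N Nne] by auto
  have r: "h q1 < 0" using q1(1) h by (auto simp: N_def)
  obtain q2 where q2: "\<And>p. p \<in> topspace X \<Longrightarrow> \<bar>\<theta> p\<bar> \<le> \<bar>\<theta> q2\<bar>"
    using compact_space_attains_inf[OF X neg(2) closedin_topspace] p by (metis empty_iff neg_le_iff_le)
  \<comment> \<open>Adding 1 makes \<open>B\<close> a positive divisor even if \<open>\<theta>\<close> vanishes identically.\<close>
  define B where "B = \<bar>\<theta> q2\<bar> + 1"
  have B: "B > 0" "\<And>p. p \<in> topspace X \<Longrightarrow> \<bar>\<theta> p\<bar> \<le> B" using q2 by (force simp: B_def)+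
  \<comment> \<open>With this choice \<open>2 B e\<close>, a bound for \<open>2 \<theta> K w\<close> at the minimizer, is half of the gap \<open>- h q1\<close>.\<close>
  define e where "e = - h q1 / (4 * B)"
  have e: "e > 0" unfolding e_def using r B(1) by (intro divide_pos_pos) auto
  \<comment> \<open>\<open>C\<close> is the part away from \<open>N\<close>, where \<open>\<theta>\<close> is too small or \<open>h\<close> is not negative enough.\<close>
  define C where "C = {p \<in> topspace X. \<theta> p \<in> {..\<theta> q0 - e}} \<union> {p \<in> topspace X. h p \<in> {h q1 / 2..}}"
  have C: "closedin X C"
    unfolding C_def
    by (intro closedin_Un closedin_continuous_map_preimage[OF cont(1)] closedin_continuous_map_preimage[OF cont(3)]) auto
  have CX: "C \<subseteq> topspace X" by (auto simp: C_def)
  have "C \<inter> N = {}" using q0(2) q1(2) e r by (force simp: C_def)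
  then have wC: "w p > 0" if "p \<in> C" for p
    using that w[of p] CX by (force simp: N_def)
  obtain d where d: "d > 0" "\<And>p. p \<in> C \<Longrightarrow> d \<le> w p"
  proof (cases "C = {}")
    case True
    then show thesis by (intro that[of 1]) auto
  next
    case False
    then obtain q where "q \<in> C" "\<And>p. p \<in> C \<Longrightarrow> w q \<le> w p"
      using compact_space_attains_inf[OF X cont(2) C] by blast
    then show thesis using wC by (intro that[of "w q"]) auto
  qed
  \<comment> \<open>On \<open>C\<close> the penalty exceeds \<open>\<theta> q0 + B\<close>, so no minimizer of \<open>\<theta> + K w\<close> lies there.\<close>
  define K where "K = (\<theta> q0 + B + 1) / d"
  have K0: "K > 0" using B(2)[of q0] q0(1) d by (auto simp: K_def N_def)
  have "continuous_map X euclideanreal (\<lambda>p. \<theta> p + K * w p)"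
    using cont by (intro continuous_map_add continuous_map_real_mult) auto
  then obtain q where q: "q \<in> topspace X" "\<And>p. p \<in> topspace X \<Longrightarrow> \<theta> q + K * w q \<le> \<theta> p + K * w p"
    using compact_space_attains_inf[OF X _ closedin_topspace] p by blast
  have le: "\<theta> q + K * w q \<le> \<theta> q0" using q(2)[of q0] q0(1) by (auto simp: N_def)
  have "q \<notin> C"
  proof
    assume "q \<in> C"
    then have "K * d \<le> K * w q" using d(2) K0 by simp
    then have "\<theta> q0 + B + 1 \<le> K * w q" using d(1) by (simp add: K_def)
    then show False using le B(2)[OF q(1)] by linarith
  qed
  then have \<theta>q: "\<theta> q > \<theta> q0 - e" and hq: "h q < h q1 / 2"
    using q(1) by (auto simp: C_def)
  have Kw: "0 \<le> K * w q" "K * w q < e" using K0 w[OF q(1)] le \<theta>q by auto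
  have "\<bar>\<theta> q * (K * w q)\<bar> \<le> B * e"
    unfolding abs_mult using Kw B by (intro mult_mono B(2)[OF q(1)]) auto
  also have "B * e = - h q1 / 4" using B(1) by (simp add: e_def)
  finally have "2 * (\<theta> q * (K * w q)) \<ge> h q1 / 2" by linarith
  moreover have "h q = 2 * (\<theta> q * (K * w q))"
    using crit[OF q] by (simp add: mult_ac)
  ultimately show False using hq by linarith
qed

lemma smooth_atlas_inj_on: "smooth_atlas M A \<Longrightarrow> c \<in> A \<Longrightarrow> inj_on (snd c) (fst c)"
  by (metis homeomorphic_imp_injective_map openin_subset smooth_atlas_def topspace_subtopology_subset)

lemma transition_chart:
  assumes "smooth_atlas M A" "c \<in> A" "p \<in> fst c"
  shows "transition c d (snd c p) = snd d p"
  using smooth_atlas_inj_on[OF assms(1,2)] assms(3) by (simp add: transition_def)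

text \<open>Compatible continuous functions on the chart images are the coordinate expressions of one continuous
  function on the manifold.\<close>

lemma chart_functions_glue:
  fixes f :: "('a, 'n::finite) chart \<Rightarrow> real^'n \<Rightarrow> real"
  assumes A: "smooth_atlas M A"
    and cont: "\<And>c. c \<in> A \<Longrightarrow> continuous_on (chart_image c) (f c)"
    and f: "\<And>c d x. c \<in> A \<Longrightarrow> d \<in> A \<Longrightarrow> x \<in> overlap c d \<Longrightarrow> f d (transition c d x) = f c x"
  obtains F where "continuous_map M euclideanreal F" "\<And>c p. c \<in> A \<Longrightarrow> p \<in> fst c \<Longrightarrow> F p = f c (snd c p)"
proof -
  have sub: "fst c \<subseteq> topspace M" if "c \<in> A" for c
    using A that by (auto simp: smooth_atlas_def openin_subset)
  obtain F where F: "continuous_map M euclideanreal F"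
      "\<And>p c. c \<in> A \<Longrightarrow> p \<in> topspace M \<inter> fst c \<Longrightarrow> F p = (f c \<circ> snd c) p"
  proof (rule pasting_lemma_exists[of M fst A euclideanreal "\<lambda>c. f c \<circ> snd c"])
    show "topspace M \<subseteq> \<Union> (fst ` A)" using A by (simp add: smooth_atlas_def)
    show "openin M (fst c)" if "c \<in> A" for c using A that by (simp add: smooth_atlas_def)
    show "continuous_map (subtopology M (fst c)) euclideanreal (f c \<circ> snd c)" if "c \<in> A" for c
    proof (rule continuous_map_compose)
      show "continuous_map (subtopology M (fst c)) (top_of_set (chart_image c)) (snd c)"
        using A that by (auto simp: smooth_atlas_def intro: homeomorphic_imp_continuous_map)
      show "continuous_map (top_of_set (chart_image c)) euclideanreal (f c)"
        using cont[OF that] by simp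
    qed
    show "(f c \<circ> snd c) p = (f d \<circ> snd d) p" if "c \<in> A" "d \<in> A" "p \<in> topspace M \<inter> fst c \<inter> fst d" for c d p
      using f[of c d "snd c p"] transition_chart[OF A, of c p d] that by (auto simp: overlap_def)
  qed blast
  show thesis
    by (rule that[OF F(1)]) (metis F(2) sub Int_iff comp_apply subsetD)
qed

lemma riemannian_manifold_charts:
  assumes "riemannian_manifold M A g" "smooth_vector_field A \<zeta>" "c \<in> A"
  shows "metric_on (chart_image c) (g c)" "smooth_on (chart_image c) (\<zeta> c)"
  using assms by (auto simp: riemannian_manifold_def riemannian_metric_def smooth_vector_field_def)

lemma riemannian_manifold_transitions:
  assumes M: "riemannian_manifold M A g" and \<zeta>: "smooth_vector_field A \<zeta>" and c: "c \<in> A" and d: "d \<in> A"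
  shows "smooth_on (overlap c d) (transition c d)"
    and "overlap c d \<subseteq> chart_image c"
    and "\<And>y. y \<in> overlap c d \<Longrightarrow> transition c d y \<in> chart_image d"
    and "\<And>y u v. y \<in> overlap c d \<Longrightarrow> gram_form (g d (transition c d y))
      (D (transition c d) y u) (D (transition c d) y v) = gram_form (g c y) u v"
    and "\<And>y. y \<in> overlap c d \<Longrightarrow> \<zeta> d (transition c d y) = D (transition c d) y (\<zeta> c y)"
proof -
  have A: "smooth_atlas M A" using M by (simp add: riemannian_manifold_def smooth_manifold_def)
  show "smooth_on (overlap c d) (transition c d)" using A c d by (simp add: smooth_atlas_def)
  show "overlap c d \<subseteq> chart_image c" by (auto simp: overlap_def chart_image_def)
  show "transition c d y \<in> chart_image d" if y: "y \<in> overlap c d" for y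
  proof -
    obtain p where "p \<in> fst c" "p \<in> fst d" "y = snd c p" using y unfolding overlap_def by blast
    then show ?thesis using transition_chart[OF A c, of p d] by (simp add: chart_image_def)
  qed
  show "gram_form (g d (transition c d y)) (D (transition c d) y u) (D (transition c d) y v) = gram_form (g c y) u v"
    if "y \<in> overlap c d" for y u v
    using M c d that by (simp add: riemannian_manifold_def riemannian_metric_def)
  show "\<zeta> d (transition c d y) = D (transition c d) y (\<zeta> c y)" if "y \<in> overlap c d" for y
    using \<zeta> c d that by (simp add: smooth_vector_field_def)
qed

lemma dual_one_form_eq_flat: "dual_one_form g \<zeta> c = flat (g c) (\<zeta> c)"
  by (simp add: fun_eq_iff dual_one_form_def flat_def)

lemma smooth_one_form_dual:
  assumes M: "riemannian_manifold M A g" and \<zeta>: "smooth_vector_field A \<zeta>"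
  shows "smooth_one_form A (dual_one_form g \<zeta>)"
  unfolding smooth_one_form_def dual_one_form_eq_flat
proof (intro conjI ballI allI)
  show "linear (flat (g c) (\<zeta> c) x)" for c x
    unfolding flat_def[abs_def] by (rule linear_gram_form)
  show "smooth_on (chart_image c) (\<lambda>x. flat (g c) (\<zeta> c) x v)" if "c \<in> A" for c v
    by (rule smooth_flat[OF riemannian_manifold_charts[OF M \<zeta> that]])
  show "flat (g d) (\<zeta> d) (transition c d x) (D (transition c d) x v) = flat (g c) (\<zeta> c) x v"
    if "c \<in> A" "d \<in> A" "x \<in> overlap c d" for c d x v
    by (rule flat_transform[OF riemannian_manifold_charts(1)[OF M \<zeta> that(1)] riemannian_manifold_charts(1)[OF M \<zeta> that(2)]
          riemannian_manifold_charts(2)[OF M \<zeta> that(1)] riemannian_manifold_charts(2)[OF M \<zeta> that(2)]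
          riemannian_manifold_transitions[OF M \<zeta> that(1,2)] that(3)])
qed

theorem corollary4:
  fixes M :: "'a topology"
    and A :: "('a, 3) chart set"
    and g :: "('a, 3) chart \<Rightarrow> real^3 \<Rightarrow> real^3^3"
    and \<zeta> :: "('a, 3) chart \<Rightarrow> real^3 \<Rightarrow> real^3"
  assumes "riemannian_manifold M A g"
    and "compact_space M"
    and "smooth_vector_field A \<zeta>"
    and "\<And>c x. c \<in> A \<Longrightarrow> x \<in> chart_image c \<Longrightarrow> gram_form (g c x) (\<zeta> c x) (\<zeta> c x) = 1"
    and "\<And>c x. c \<in> A \<Longrightarrow> x \<in> chart_image c \<Longrightarrow> cov_deriv (g c) (\<zeta> c) (\<zeta> c) x = 0"
    and "\<And>c x. c \<in> A \<Longrightarrow> x \<in> chart_image c \<Longrightarrow> ricci (g c) x (\<zeta> c x) (\<zeta> c x) > 0"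
  shows "contact_form_3 A (dual_one_form g \<zeta>)"
proof -
  note M = assms(1) and X = assms(2) and \<zeta> = assms(3) and unit = assms(4) and ric = assms(6)
  have geo: "nabla (g c) (\<zeta> c) x (\<zeta> c x) = 0" if "c \<in> A" "x \<in> chart_image c" for c x
    using assms(5)[OF that] by (simp add: cov_deriv_eq_nabla)
  have A: "smooth_atlas M A" using M by (simp add: riemannian_manifold_def smooth_manifold_def)
  note chart = riemannian_manifold_charts[OF M \<zeta>]
  have charts: "\<exists>c\<in>A. p \<in> fst c" if "p \<in> topspace M" for p
    using A that by (auto simp: smooth_atlas_def)
  have sub: "fst c \<subseteq> topspace M" if "c \<in> A" for c
    using A that by (auto simp: smooth_atlas_def openin_subset)
  define h where "h c x = D (divergence (g c) (\<zeta> c)) x (\<zeta> c x)" for c x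
  have smooth_div: "smooth_on (chart_image c) (divergence (g c) (\<zeta> c))" if "c \<in> A" for c
    by (rule smooth_divergence[OF chart[OF that]])
  have invariant: "divergence (g d) (\<zeta> d) (transition c d x) = divergence (g c) (\<zeta> c) x"
      "h d (transition c d x) = h c x"
      "twist_sq (g d) (\<zeta> d) (transition c d x) = twist_sq (g c) (\<zeta> c) x"
    if "c \<in> A" "d \<in> A" "x \<in> overlap c d" for c d x
  proof -
    note t = chart(1)[OF that(1)] chart(1)[OF that(2)] chart(2)[OF that(1)] chart(2)[OF that(2)]
      riemannian_manifold_transitions[OF M \<zeta> that(1,2)] that(3)
    show "divergence (g d) (\<zeta> d) (transition c d x) = divergence (g c) (\<zeta> c) x"
      by (rule divergence_transform[OF t])
    show "h d (transition c d x) = h c x"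
      unfolding h_def by (rule divergence_deriv_transform[OF t])
    show "twist_sq (g d) (\<zeta> d) (transition c d x) = twist_sq (g c) (\<zeta> c) x"
      by (rule twist_sq_transform[OF t])
  qed
  have cont_h: "continuous_on (chart_image c) (h c)" if c: "c \<in> A" for c
  proof (rule smooth_on_continuous_on, rule smooth_on_cong)
    show "smooth_on (chart_image c) (\<lambda>x. \<Sum>i\<in>UNIV. (\<zeta> c x $ i) *\<^sub>R D (divergence (g c) (\<zeta> c)) x (axis i 1))"
      by (intro smooth_on_sum open_U[OF chart(1)[OF c]] smooth_on_scaleR smooth_on_nth chart c smooth_on_D smooth_div)
    show "(\<Sum>i\<in>UNIV. (\<zeta> c x $ i) *\<^sub>R D (divergence (g c) (\<zeta> c)) x (axis i 1)) = h c x" if "x \<in> chart_image c" for x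
      unfolding h_def by (rule linear_expand[OF linear_D[OF smooth_div[OF c] that], symmetric])
  qed
  obtain h' where h': "continuous_map M euclideanreal h'" "\<And>c p. c \<in> A \<Longrightarrow> p \<in> fst c \<Longrightarrow> h' p = h c (snd c p)"
    using chart_functions_glue[OF A cont_h invariant(2)] by blast
  obtain \<theta> where \<theta>: "continuous_map M euclideanreal \<theta>"
      "\<And>c p. c \<in> A \<Longrightarrow> p \<in> fst c \<Longrightarrow> \<theta> p = divergence (g c) (\<zeta> c) (snd c p)"
    using chart_functions_glue[OF A smooth_on_continuous_on[OF smooth_div] invariant(1)] by blast
  obtain w where w: "continuous_map M euclideanreal w"
      "\<And>c p. c \<in> A \<Longrightarrow> p \<in> fst c \<Longrightarrow> w p = twist_sq (g c) (\<zeta> c) (snd c p)"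
    using chart_functions_glue[OF A smooth_on_continuous_on[OF smooth_twist_sq[OF chart]] invariant(3)] by blast
  have pos: "w p > 0" if "p \<in> topspace M" for p
  proof (rule penalty_positive_on_compact[OF X \<theta>(1) w(1) h'(1) _ _ _ that])
    fix p assume "p \<in> topspace M"
    then obtain c where c: "c \<in> A" "p \<in> fst c" using charts by blast
    then have x: "snd c p \<in> chart_image c" by (simp add: chart_image_def)
    show "w p \<ge> 0" using twist_sq_nonneg[OF chart[OF c(1)] x] by (simp add: w(2)[OF c])
    show "h' p < 0" if "w p = 0"
      using that twist_sq_eq_0_iff[OF chart[OF c(1)] x]
        divergence_decreasing_if_no_twist[OF chart[OF c(1)] unit[OF c(1)] geo[OF c(1)] x _ ric[OF c(1) x]]
      by (simp add: w(2)[OF c] h'(2)[OF c] h_def)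
  next
    fix K q
    assume q: "q \<in> topspace M" and min: "\<And>p. p \<in> topspace M \<Longrightarrow> \<theta> q + K * w q \<le> \<theta> p + K * w p"
    obtain c where c: "c \<in> A" "q \<in> fst c" using charts q by blast
    define x where "x = snd c q"
    have x: "x \<in> chart_image c" using c by (simp add: chart_image_def x_def)
    let ?t = "divergence (g c) (\<zeta> c)" and ?w = "twist_sq (g c) (\<zeta> c)"
    have der: "((\<lambda>y. ?t y + K * ?w y) has_derivative (\<lambda>u. D ?t x u + K * D ?w x u)) (at x)"
      by (intro has_derivative_add has_derivative_mult_right smooth_on_has_derivative[OF _ x]
          smooth_div c smooth_twist_sq[OF chart[OF c(1)]])
    have "?t x + K * ?w x \<le> ?t y + K * ?w y" if "y \<in> chart_image c" for y
    proof -
      obtain p where "p \<in> fst c" "y = snd c p" using \<open>y \<in> chart_image c\<close> by (auto simp: chart_image_def)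
      then show ?thesis using min[of p] sub[OF c(1)] c by (auto simp: \<theta>(2) w(2) x_def)
    qed
    then have "(\<lambda>u. D ?t x u + K * D ?w x u) = (\<lambda>u. 0)"
      by (intro differential_zero_maxmin[OF x open_U[OF chart(1)[OF c(1)]] der]) blast
    then have "D ?t x (\<zeta> c x) + K * D ?w x (\<zeta> c x) = 0" by (rule fun_cong)
    then show "h' q = 2 * K * \<theta> q * w q"
      using twist_sq_transport[OF chart[OF c(1)] unit[OF c(1)] geo[OF c(1)] x]
      by (simp add: h'(2)[OF c] \<theta>(2)[OF c] w(2)[OF c] h_def flip: x_def)
  qed
  show ?thesis
    unfolding contact_form_3_def
  proof (intro conjI ballI)
    show "smooth_one_form A (dual_one_form g \<zeta>)" by (rule smooth_one_form_dual[OF M \<zeta>])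
    fix c x assume c: "c \<in> A" and x: "x \<in> chart_image c"
    obtain p where p: "p \<in> fst c" "x = snd c p" using x by (auto simp: chart_image_def)
    then have "twist_sq (g c) (\<zeta> c) x > 0" using pos[of p] w(2)[OF c p(1)] sub[OF c] by auto
    then have "contact_density (g c) (\<zeta> c) x \<noteq> 0" by (auto simp: twist_sq_def)
    then show "\<exists>u v w. wedge12 (dual_one_form g \<zeta> c x) (ext_deriv (dual_one_form g \<zeta> c) x) u v w \<noteq> 0"
      unfolding dual_one_form_eq_flat contact_density_def by blast
  qed
qed

end
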